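(* Let $\Omega\subset\mathbb{H}$ be open and bounded, and assume that for every $x\in\Omega$ the connected components of $H(x)\cap\Omega$ are convex. Then $$\int_{\Omega}\frac{|u(x)|^2}{\omega(x)^2}\,dx\;\le\;4\int_\Omega |\nabla_{\mathbb{H}}u(x)|^2\,dx\qquad\text{for all }u\in C_0^\infty(\Omega),$$ where $\omega(x):=\inf_{y\in\partial\Omega\cap H(x)}d_C(x,y)$, and moreover, for $x\in\Omega$, $$\omega(x)=\inf_{y\in\partial\Omega\cap H(x)}\|(-y)\boxplus x\|_{\mathbb{H}}=\inf_{y\in\partial\Omega\cap H(x)}\sqrt{(x_1-y_1)^2+(x_2-y_2)^2}.$$
   Context: $\mathbb{H}$ is the first Heisenberg group: $\mathbb{R}^3$ with the group law $(x_1,x_2,x_3)\boxplus(y_1,y_2,y_3)=\left(x_1+y_1,\;x_2+y_2,\;x_3+y_3-\tfrac12(x_1y_2-x_2y_1)\right)$. Topological notions, convexity and $dx$ (Lebesgue measure) are those of $\mathbb{R}^3$. The sub-gradient is $\nabla_{\mathbb{H}}=(X_1,X_2)$ with $X_1=\partial_{x_1}+\frac{x_2}{2}\partial_{x_3}$, $X_2=\partial_{x_2}-\frac{x_1}{2}\partial_{x_3}$, so $|\nabla_{\mathbb{H}}u|^2=|X_1u|^2+|X_2u|^2$. The Kaplan gauge is $\|x\|_{\mathbb{H}}$ with $\|x\|_{\mathbb{H}}^4=(x_1^2+x_2^2)^2+16x_3^2$. The tangent plane to $x\in\mathbb{H}$ is $H(x)=\{y\in\mathbb{H}: \langle(-\tfrac{x_2}{2},\tfrac{x_1}{2},1),\,y-x\rangle=0\}=\{y\in\mathbb{H}: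 x_1y_2-x_2y_1=2(x_3-y_3)\}$, with $\langle\cdot,\cdot\rangle$ the Euclidean scalar product. A Lipschitz curve $\gamma=(\gamma_1,\gamma_2,\gamma_3):[a,b]\to\mathbb{H}$ is horizontal if $\gamma'(t)\in\mathrm{span}\{(1,0,\gamma_2(t)/2),(0,1,-\gamma_1(t)/2)\}$ (for a.e. $t$). The Carnot-Carathéodory distance is $d_C(x,y)=\inf_\gamma\int_a^b\sqrt{\gamma_1'(t)^2+\gamma_2'(t)^2}\,dt$, the infimum being over all horizontal curves $\gamma$ connecting $x$ and $y$. $C_0^\infty(\Omega)$ denotes smooth functions with compact support in $\Omega$. *)

theory Defs
  imports "HOL-Analysis.Analysis"
begin

type_synonym heis = "real^3"

definition hmul :: "heis \<Rightarrow> heis \<Rightarrow> heis" (infixl "\<boxplus>" 65) where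
  "x \<boxplus> y = vector [x$1 + y$1, x$2 + y$2, x$3 + y$3 - (x$1 * y$2 - x$2 * y$1) / 2]"

definition kaplan_gauge :: "heis \<Rightarrow> real" where
  "kaplan_gauge x = root 4 (((x$1)\<^sup>2 + (x$2)\<^sup>2)\<^sup>2 + 16 * (x$3)\<^sup>2)"

definition tangent_plane :: "heis \<Rightarrow> heis set" where
  "tangent_plane x = {y. (vector [- (x$2 / 2), x$1 / 2, 1] :: heis) \<bullet> (y - x) = 0}"

text \<open>Derivatives at the end points of the interval are one-sided. A Lipschitz curve is
  differentiable almost everywhere, so requiring existence of the derivative almost everywhere
  is no restriction.\<close>

definition horizontal_curve :: "real \<Rightarrow> real \<Rightarrow> (real \<Rightarrow> heis) \<Rightarrow> bool" where
  "horizontal_curve a b \<gamma> \<longleftrightarrow>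
     (\<exists>L. L-lipschitz_on {a..b} \<gamma>) \<and>
     (AE t in lebesgue. t \<in> {a..b} \<longrightarrow>
        (\<exists>v. (\<gamma> has_vector_derivative v) (at t within {a..b}) \<and>
             v \<in> span {vector [1, 0, \<gamma> t $ 2 / 2], vector [0, 1, - (\<gamma> t $ 1 / 2)]}))"

definition horizontal_length :: "real \<Rightarrow> real \<Rightarrow> (real \<Rightarrow> heis) \<Rightarrow> real" where
  "horizontal_length a b \<gamma> =
     integral {a..b} (\<lambda>t. sqrt ((vector_derivative \<gamma> (at t within {a..b}) $ 1)\<^sup>2 +
                               (vector_derivative \<gamma> (at t within {a..b}) $ 2)\<^sup>2))"

text \<open>The set of lengths is bounded below by 0 and nonempty, since any two points can be joined
  by a horizontal curve; hence the real-valued infimum is the intended one.\<close>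

definition cc_dist :: "heis \<Rightarrow> heis \<Rightarrow> real" where
  "cc_dist x y =
     Inf {horizontal_length a b \<gamma> | a b \<gamma>.
            a < b \<and> horizontal_curve a b \<gamma> \<and> \<gamma> a = x \<and> \<gamma> b = y}"

text \<open>For bounded \<open>\<Omega>\<close> and \<open>x \<in> \<Omega>\<close> the index set is nonempty, because every line through
  \<open>x\<close> in its tangent plane leaves \<open>\<Omega>\<close>.\<close>

definition omega :: "heis set \<Rightarrow> heis \<Rightarrow> real" where
  "omega \<Omega> x = (INF y \<in> frontier \<Omega> \<inter> tangent_plane x. cc_dist x y)"

definition partial :: "3 \<Rightarrow> (heis \<Rightarrow> complex) \<Rightarrow> heis \<Rightarrow> complex" where
  "partial i u x = frechet_derivative u (at x) (axis i 1)"

primrec Ck :: "nat \<Rightarrow> (heis \<Rightarrow> complex) \<Rightarrow> bool" where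
  "Ck 0 u \<longleftrightarrow> continuous_on UNIV u"
| "Ck (Suc k) u \<longleftrightarrow> (\<forall>x. u differentiable (at x)) \<and> (\<forall>i. Ck k (partial i u))"

text \<open>A function in \<open>C\<^sub>0\<^sup>\<infinity>(\<Omega>)\<close> is represented by its extension by zero, which is smooth on the
  whole space because its support is a compact subset of \<open>\<Omega>\<close>.\<close>

definition test_functions :: "heis set \<Rightarrow> (heis \<Rightarrow> complex) set" where
  "test_functions \<Omega> =
     {u. (\<forall>k. Ck k u) \<and> compact (closure {x. u x \<noteq> 0}) \<and> closure {x. u x \<noteq> 0} \<subseteq> \<Omega>}"

definition X1 :: "(heis \<Rightarrow> complex) \<Rightarrow> heis \<Rightarrow> complex" where
  "X1 u x = partial 1 u x + complex_of_real (x$2 / 2) * partial 3 u x"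

definition X2 :: "(heis \<Rightarrow> complex) \<Rightarrow> heis \<Rightarrow> complex" where
  "X2 u x = partial 2 u x - complex_of_real (x$1 / 2) * partial 3 u x"

definition subgrad_norm_sq :: "(heis \<Rightarrow> complex) \<Rightarrow> heis \<Rightarrow> real" where
  "subgrad_norm_sq u x = (cmod (X1 u x))\<^sup>2 + (cmod (X2 u x))\<^sup>2"

end

theory Submission
  imports Defs
begin

text \<open>The proof reduces the inequality to the one-dimensional Hardy inequality on the straight
  horizontal lines in the two directions \<open>X\<^sub>1\<close> and \<open>X\<^sub>2\<close>.

  The integral curves of a constant-coefficient horizontal field \<open>w\<^sub>1 X\<^sub>1 + w\<^sub>2 X\<^sub>2\<close> are straight lines,
  and the lines of all these fields through \<open>x\<close> fill the plane \<open>H(x)\<close>. Hence the segment from \<open>x\<close> to a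
  point \<open>y\<close> of \<open>H(x)\<close> is a horizontal curve whose length is the Euclidean length of its projection to the
  first two coordinates. No horizontal curve is shorter, because the length of the projected curve is
  at least its displacement (this uses the fundamental theorem of calculus for Lipschitz curves). So
  \<open>d\<^sub>C(x, y)\<close> is the projected Euclidean distance (\<open>cc_dist_tangent_plane\<close>). The Kaplan gauge agrees with
  it, since the third coordinate of \<open>(-y) \<boxplus> x\<close> vanishes exactly when \<open>y\<close> lies in \<open>H(x)\<close>. This gives both
  formulas for \<open>\<omega>\<close>.

  For the inequality, let \<open>d\<^sub>i(x)\<close> be the distance from \<open>x\<close> to the complement of \<open>\<Omega>\<close> measured along the
  line of \<open>X\<^sub>i\<close> through \<open>x\<close>. Convexity enters only through
  \<open>1 / \<omega>\<^sup>2 \<le> 1 / d\<^sub>1\<^sup>2 + 1 / d\<^sub>2\<^sup>2\<close> (\<open>inverse_omega_sq_le\<close>): a boundary point \<open>y\<close> in \<open>H(x)\<close> is separated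
  by a line of the plane \<open>H(x)\<close> from the convex component containing \<open>x\<close>; if \<open>e\<close> is a unit normal of that
  line, then the axis directions meet it at distances at most \<open>\<rho> / \<bar>e\<^sub>i\<bar>\<close> (when \<open>e\<^sub>i \<noteq> 0\<close>), where \<open>\<rho>\<close> is the
  projected distance from \<open>x\<close> to \<open>y\<close>, and \<open>e\<^sub>1\<^sup>2 + e\<^sub>2\<^sup>2 = 1\<close>.

  It remains to show \<open>\<integral> |u|\<^sup>2 / d\<^sub>i\<^sup>2 \<le> 4 \<integral> |X\<^sub>i u|\<^sup>2\<close> for each \<open>i\<close> and to add (\<open>hardy_flow\<close>). The flow of
  \<open>X\<^sub>i\<close> consists of volume-preserving affine maps, so both integrals split into integrals over the lines of
  the flow (\<open>nn_integral_flow_lines\<close>), and on each line the claim is the Hardy inequality with the sharp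
  constant for the distance to the complement of a bounded open set (\<open>hardy_open_real\<close>).\<close>

section \<open>The fundamental theorem of calculus for Lipschitz curves\<close>

lemma has_vector_derivative_imp_diff_quotient_LIMSEQ:
  fixes f :: "real \<Rightarrow> 'a::real_normed_vector"
  assumes "(f has_vector_derivative D) (at x)"
  shows "(\<lambda>n. real (Suc n) *\<^sub>R (f (x + 1 / real (Suc n)) - f x)) \<longlonglongrightarrow> D"
proof -
  have "((\<lambda>h. (1 / h) *\<^sub>R (f (x + h) - f x)) \<longlongrightarrow> D) (at 0)"
  proof -
    have "((\<lambda>y. (f y - (f x + (y - x) *\<^sub>R D)) /\<^sub>R norm (y - x)) \<longlongrightarrow> 0) (at x)"
      using assms by (auto simp add: has_vector_derivative_def has_derivative_within divide_inverse_commute simp flip: inverse_eq_divide)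
    hence "((\<lambda>h. (f (x + h) - (f x + h *\<^sub>R D)) /\<^sub>R norm h) \<longlongrightarrow> 0) (at 0)"
      by (drule_tac LIM_offset_zero) simp
    hence "((\<lambda>h. norm ((f (x + h) - (f x + h *\<^sub>R D)) /\<^sub>R norm h)) \<longlongrightarrow> 0) (at 0)"
      by (rule tendsto_norm_zero)
    hence "((\<lambda>h. norm ((1 / h) *\<^sub>R (f (x + h) - f x) - D)) \<longlongrightarrow> 0) (at 0)"
    proof (rule Lim_transform_eventually)
      show "\<forall>\<^sub>F h in at 0. norm ((f (x + h) - (f x + h *\<^sub>R D)) /\<^sub>R norm h)
              = norm ((1 / h) *\<^sub>R (f (x + h) - f x) - D)"
      proof (rule eventually_mono[OF eventually_at_ball'[of 1]])
        fix h :: real assume "h \<in> ball 0 1 \<and> h \<noteq> 0 \<and> h \<in> UNIV"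
        hence h: "h \<noteq> 0" by auto
        have "(1 / h) *\<^sub>R (f (x + h) - f x) - D = (1 / h) *\<^sub>R (f (x + h) - (f x + h *\<^sub>R D))"
          using h by (simp add: algebra_simps)
        thus "norm ((f (x + h) - (f x + h *\<^sub>R D)) /\<^sub>R norm h) = norm ((1 / h) *\<^sub>R (f (x + h) - f x) - D)"
          by (simp add: divide_inverse)
      qed auto
    qed
    hence "((\<lambda>h. (1 / h) *\<^sub>R (f (x + h) - f x) - D) \<longlongrightarrow> 0) (at 0)"
      by (rule tendsto_norm_zero_cancel)
    thus ?thesis by (simp add: LIM_zero_iff)
  qed
  moreover have "filterlim (\<lambda>n. 1 / real (Suc n)) (at 0) sequentially"
    unfolding filterlim_at by (intro conjI lim_1_over_n LIMSEQ_Suc) (auto intro: LIMSEQ_Suc lim_1_over_n)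
  ultimately have "(\<lambda>n. (1 / (1 / real (Suc n))) *\<^sub>R (f (x + 1 / real (Suc n)) - f x)) \<longlonglongrightarrow> D"
    by (rule filterlim_compose)
  thus ?thesis by simp
qed

text \<open>The difference quotients of a Lipschitz function are bounded by the Lipschitz constant and converge to
  the derivative outside the null set, so dominated convergence applies; their integrals are difference
  quotients of an antiderivative at the two end points. The same convergence bounds the derivative.\<close>

lemma fundamental_theorem_of_calculus_lipschitz:
  fixes f :: "real \<Rightarrow> 'a::euclidean_space"
  assumes ab: "a < b" and lip: "L-lipschitz_on {a..b} f" and N: "negligible N"
    and der: "\<And>t. t \<in> {a..b} - N \<Longrightarrow> (f has_vector_derivative f' t) (at t within {a..b})"
  shows "(f' has_integral f b - f a) {a..b}"
    and "\<And>t. t \<in> {a<..<b} - N \<Longrightarrow> norm (f' t) \<le> L"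
proof -
  \<comment> \<open>Extending by constants keeps the Lipschitz constant and makes the quotients near \<open>b\<close> meaningful.\<close>
  define g where "g t = f (max a (min b t))" for t
  have L0: "0 \<le> L" using lip lipschitz_on_nonneg by blast
  have glip: "norm (g s - g t) \<le> L * \<bar>s - t\<bar>" for s t
  proof -
    have "norm (g s - g t) \<le> L * \<bar>max a (min b s) - max a (min b t)\<bar>"
      using lipschitz_onD[OF lip, of "max a (min b s)" "max a (min b t)"] ab
      by (auto simp: g_def dist_norm)
    also have "\<dots> \<le> L * \<bar>s - t\<bar>"
      by (rule mult_left_mono[OF _ L0]) auto
    finally show ?thesis .
  qed
  have "L-lipschitz_on UNIV g"
    using glip L0 by (intro lipschitz_onI) (auto simp: dist_norm)
  hence gcont: "continuous_on A g" for A
    using continuous_on_subset lipschitz_on_continuous_on by blast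
  \<comment> \<open>The margins leave room for the increments \<open>1 / Suc n \<le> 1\<close>.\<close>
  obtain G where G: "\<And>x. x \<in> {a-1..b+2} \<Longrightarrow> (G has_vector_derivative g x) (at x within {a-1..b+2})"
    using antiderivative_continuous[OF gcont[of "{a-1..b+2}"]] by blast
  have Gat: "(G has_vector_derivative g x) (at x)" if "a - 1 < x" "x < b + 2" for x
    using G[of x] that at_within_interior[of x "{a-1..b+2}"] by (auto simp: interior_atLeastAtMost_real)
  define q where "q n t = real (Suc n) *\<^sub>R (g (t + 1 / real (Suc n)) - g t)" for n t
  define Q where "Q n t = real (Suc n) *\<^sub>R (G (t + 1 / real (Suc n)) - G t)" for n t
  have qbound: "norm (q n t) \<le> L" for n t
  proof -
    have "norm (q n t) = real (Suc n) * norm (g (t + 1 / real (Suc n)) - g t)"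
      by (simp add: q_def)
    also have "\<dots> \<le> real (Suc n) * (L * \<bar>(t + 1 / real (Suc n)) - t\<bar>)"
      by (intro mult_left_mono glip) auto
    also have "\<dots> = L" by (simp add: field_simps)
    finally show ?thesis .
  qed
  have qconv: "(\<lambda>n. q n t) \<longlonglongrightarrow> f' t" if t: "t \<in> {a<..<b} - N" for t
  proof -
    have "(f has_vector_derivative f' t) (at t)"
      using der[of t] t at_within_interior[of t "{a..b}"] by (auto simp: interior_atLeastAtMost_real)
    hence "(g has_vector_derivative f' t) (at t)"
      by (rule has_vector_derivative_transform_within_open[where S="{a<..<b}"])
         (use t in \<open>auto simp: g_def\<close>)
    thus ?thesis unfolding q_def by (rule has_vector_derivative_imp_diff_quotient_LIMSEQ)
  qed
  show "norm (f' t) \<le> L" if t: "t \<in> {a<..<b} - N" for t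
    by (rule Lim_norm_ubound[OF _ qconv[OF t]]) (auto simp: qbound)
  have Qint: "(q n has_integral Q n b - Q n a) {a..b}" for n
  proof (rule fundamental_theorem_of_calculus)
    fix t assume t: "t \<in> {a..b}"
    have n: "0 < 1 / real (Suc n)" "1 / real (Suc n) \<le> 1" by auto
    have 1: "(G has_vector_derivative g (t + 1 / real (Suc n))) (at (t + 1 / real (Suc n)))"
      using n t unfolding atLeastAtMost_iff by (intro Gat) linarith+
    have "(G \<circ> (\<lambda>t. t + 1 / real (Suc n)) has_vector_derivative 1 *\<^sub>R g (t + 1 / real (Suc n))) (at t)"
      by (rule vector_diff_chain_at[where f="\<lambda>t. t + 1 / real (Suc n)" and x=t, OF _ 1]) (auto intro!: derivative_eq_intros)
    moreover have "(G has_vector_derivative g t) (at t)" using t by (intro Gat) auto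
    ultimately have "(Q n has_vector_derivative q n t) (at t)"
      unfolding Q_def q_def o_def by (auto intro!: derivative_eq_intros)
    thus "(Q n has_vector_derivative q n t) (at t within {a..b})"
      by (rule has_vector_derivative_at_within)
  qed (use ab in auto)
  have "(\<lambda>n. Q n t) \<longlonglongrightarrow> g t" if "t \<in> {a..b}" for t
    unfolding Q_def by (rule has_vector_derivative_imp_diff_quotient_LIMSEQ[OF Gat]) (use that in auto)
  hence Qlim: "(\<lambda>n. Q n b - Q n a) \<longlonglongrightarrow> f b - f a"
    using ab by (intro tendsto_diff) (auto simp: g_def dest: meta_spec)
  let ?M = "insert a (insert b N)"
  have neg: "negligible ?M" using N by simp
  have "((\<lambda>t. if t \<in> ?M then 0 else f' t) has_integral f b - f a) {a..b}"
  proof (rule has_integral_dominated_convergence[OF _ _ _ _ Qlim])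
    show "((\<lambda>t. if t \<in> ?M then 0 else q n t) has_integral Q n b - Q n a) {a..b}" for n
      by (rule has_integral_spike[OF neg _ Qint]) auto
    show "(\<lambda>_. L) integrable_on {a..b}" by (rule integrable_const_ivl)
    show "\<forall>x\<in>{a..b}. norm (if x \<in> ?M then 0 else q n x) \<le> L" for n using qbound L0 by auto
    show "\<forall>x\<in>{a..b}. (\<lambda>n. if x \<in> ?M then 0 else q n x) \<longlonglongrightarrow> (if x \<in> ?M then 0 else f' x)"
      using qconv by (auto simp: less_le)
  qed
  thus "(f' has_integral f b - f a) {a..b}"
    by (rule has_integral_spike[OF neg, rotated]) auto
qed

section \<open>Horizontal directions and tangent planes\<close>

definition hproj :: "heis \<Rightarrow> real \<times> real" where
  "hproj x = (x$1, x$2)"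

text \<open>The value at \<open>x\<close> of the left-invariant field \<open>w\<^sub>1 X\<^sub>1 + w\<^sub>2 X\<^sub>2\<close>.\<close>

definition hfield :: "real \<times> real \<Rightarrow> heis \<Rightarrow> heis" where
  "hfield w x = vector [fst w, snd w, (x$2 * fst w - x$1 * snd w) / 2]"

lemma hfield_nth [simp]:
  "hfield w x $ 1 = fst w" "hfield w x $ 2 = snd w" "hfield w x $ 3 = (x$2 * fst w - x$1 * snd w) / 2"
  by (auto simp: hfield_def)

lemma heis_eqI: "x$1 = y$1 \<Longrightarrow> x$2 = y$2 \<Longrightarrow> x$3 = y$3 \<Longrightarrow> x = (y::heis)"
  by (auto simp: vec_eq_iff forall_3)

lemma hproj_hfield [simp]: "hproj (hfield w x) = w"
  by (simp add: hproj_def)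

lemma bounded_linear_hproj: "bounded_linear hproj"
  unfolding hproj_def by (intro bounded_linear_Pair bounded_linear_vec_nth)

lemma norm_hproj: "norm (hproj x) = sqrt ((x$1)\<^sup>2 + (x$2)\<^sup>2)"
  by (simp add: hproj_def norm_Pair)

lemma mem_tangent_plane:
  "y \<in> tangent_plane x \<longleftrightarrow> y$3 - x$3 = (x$2 * (y$1 - x$1) - x$1 * (y$2 - x$2)) / 2"
  by (auto simp: tangent_plane_def inner_vec_def sum_3 field_simps)

lemma add_hfield_hproj: "y \<in> tangent_plane x \<Longrightarrow> x + hfield (hproj (y - x)) x = y"
  by (intro heis_eqI) (auto simp: mem_tangent_plane hproj_def field_simps)

lemma add_hfield_in_tangent_plane: "x + hfield w x \<in> tangent_plane x"
  by (simp add: mem_tangent_plane)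

lemma hfield_scaleR: "hfield (s *\<^sub>R w) x = s *\<^sub>R hfield w x"
  by (intro heis_eqI) (auto simp: field_simps)

text \<open>The field is constant along each of its lines, so the flow of the field is \<open>x \<mapsto> x + t hfield w x\<close>.\<close>

lemma hfield_along_line: "hfield w (x + t *\<^sub>R hfield w x) = hfield w x"
  by (intro heis_eqI) (auto simp: algebra_simps)

section \<open>The Carnot-Caratheodory distance inside a tangent plane\<close>

text \<open>The projected curve is Lipschitz, so its displacement is the integral of its velocity, whose norm is
  the integrand of the horizontal length. The derivative has to be shown absolutely integrable first,
  because otherwise the length would have the default value 0.\<close>

lemma norm_hproj_le_horizontal_length:
  assumes "a < b" and \<gamma>: "horizontal_curve a b \<gamma>"
  shows "norm (hproj (\<gamma> b - \<gamma> a)) \<le> horizontal_length a b \<gamma>"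
proof -
  obtain L where L: "L-lipschitz_on {a..b} \<gamma>" using \<gamma> by (auto simp: horizontal_curve_def)
  define d where "d t = vector_derivative \<gamma> (at t within {a..b})" for t
  have "AE t in lebesgue. t \<in> {a..b} \<longrightarrow> (\<gamma> has_vector_derivative d t) (at t within {a..b})"
    using \<gamma> unfolding horizontal_curve_def d_def
    by (auto elim!: eventually_mono intro: vector_derivative_works[THEN iffD1] differentiableI_vector)
  then obtain N where "negligible N"
    and N: "\<And>t. t \<in> {a..b} - N \<Longrightarrow> (\<gamma> has_vector_derivative d t) (at t within {a..b})"
    by (auto simp: eventually_ae_filter negligible_iff_null_sets)
  note ftc = fundamental_theorem_of_calculus_lipschitz[OF \<open>a < b\<close> L \<open>negligible N\<close> N]
  let ?M = "insert a (insert b N)"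
  have neg: "negligible ?M" using \<open>negligible N\<close> by simp
  define d' where "d' t = (if t \<in> ?M then 0 else d t)" for t
  have d': "(d' has_integral \<gamma> b - \<gamma> a) {a..b}"
    unfolding d'_def by (rule has_integral_spike[OF neg _ ftc(1)]) auto
  have "d' absolutely_integrable_on {a..b}"
  proof (rule absolutely_integrable_integrable_bound)
    show "norm (d' t) \<le> \<bar>L\<bar>" if "t \<in> {a..b}" for t
      using ftc(2)[of t] that by (auto simp: d'_def)
    show "d' integrable_on {a..b}" using d' by blast
  qed (rule integrable_const_ivl)
  hence "(hproj \<circ> d') absolutely_integrable_on {a..b}"
    by (rule absolutely_integrable_linear[OF _ bounded_linear_hproj])
  hence int: "(\<lambda>t. norm ((hproj \<circ> d') t)) integrable_on {a..b}"
    by (simp add: absolutely_integrable_on_def)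
  have has: "((hproj \<circ> d') has_integral hproj (\<gamma> b - \<gamma> a)) {a..b}"
    by (rule has_integral_linear[OF d' bounded_linear_hproj])
  have "norm (hproj (\<gamma> b - \<gamma> a)) = norm (integral {a..b} (hproj \<circ> d'))"
    using has by (simp add: integral_unique)
  also have "\<dots> \<le> integral {a..b} (\<lambda>t. norm ((hproj \<circ> d') t))"
    by (rule integral_norm_bound_integral) (use has int in auto)
  also have "\<dots> = horizontal_length a b \<gamma>"
    unfolding horizontal_length_def
    by (rule integral_spike[OF neg]) (auto simp: d'_def d_def norm_hproj)
  finally show ?thesis .
qed

text \<open>The direction of the segment is a value of a left-invariant field, and the segment follows the flow of
  this field; hence it stays horizontal.\<close>

lemma horizontal_segment:
  assumes "y \<in> tangent_plane x"
  defines "\<gamma> \<equiv> \<lambda>t. x + t *\<^sub>R hfield (hproj (y - x)) x"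
  shows "horizontal_curve 0 1 \<gamma>" and "horizontal_length 0 1 \<gamma> = norm (hproj (y - x))"
    and "\<gamma> 0 = x" and "\<gamma> 1 = y"
proof -
  let ?w = "hproj (y - x)"
  let ?v = "hfield ?w x"
  have der: "(\<gamma> has_vector_derivative ?v) (at t within A)" for t A
    unfolding \<gamma>_def by (auto intro!: derivative_eq_intros)
  have "?v \<in> span {vector [1, 0, \<gamma> t $ 2 / 2], vector [0, 1, - (\<gamma> t $ 1 / 2)]}" (is "_ \<in> span {?e1, ?e2}") for t
  proof -
    have "?v = fst ?w *\<^sub>R ?e1 + snd ?w *\<^sub>R ?e2"
      by (intro heis_eqI) (auto simp: \<gamma>_def field_simps)
    also have "\<dots> \<in> span {?e1, ?e2}"
      by (intro span_add span_scale span_base) auto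
    finally show ?thesis .
  qed
  moreover have "(norm ?v)-lipschitz_on {0..1} \<gamma>"
    by (rule lipschitz_onI)
       (auto simp: \<gamma>_def dist_norm algebra_simps simp flip: scaleR_diff_left norm_scaleR)
  ultimately show "horizontal_curve 0 1 \<gamma>"
    unfolding horizontal_curve_def using der by blast
  have "vector_derivative \<gamma> (at t within {0..1}) = ?v" if "t \<in> {0..1}" for t
    by (rule vector_derivative_within_closed_interval) (use that der in auto)
  hence "horizontal_length 0 1 \<gamma> = integral {0..1::real} (\<lambda>t. norm (hproj (y - x)))"
    unfolding horizontal_length_def by (intro integral_cong) (simp add: norm_hproj, simp add: hproj_def)
  thus "horizontal_length 0 1 \<gamma> = norm (hproj (y - x))" by simp
  show "\<gamma> 0 = x" "\<gamma> 1 = y" using add_hfield_hproj[OF assms(1)] by (auto simp: \<gamma>_def)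
qed

lemma cc_dist_tangent_plane:
  assumes "y \<in> tangent_plane x"
  shows "cc_dist x y = norm (hproj (y - x))"
  unfolding cc_dist_def
proof (rule cInf_eq_minimum)
  show "norm (hproj (y - x)) \<in> {horizontal_length a b \<gamma> | a b \<gamma>.
            a < b \<and> horizontal_curve a b \<gamma> \<and> \<gamma> a = x \<and> \<gamma> b = y}"
    using horizontal_segment[OF assms] by (force intro: exI[of _ "0::real"] exI[of _ "1::real"])
qed (auto dest: norm_hproj_le_horizontal_length)

lemma kaplan_gauge_tangent_plane:
  assumes "y \<in> tangent_plane x"
  shows "kaplan_gauge ((- y) \<boxplus> x) = norm (hproj (y - x))"
proof -
  have "((- y) \<boxplus> x) $ 1 = - (y - x) $ 1" "((- y) \<boxplus> x) $ 2 = - (y - x) $ 2"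
    by (auto simp: hmul_def)
  moreover have "((- y) \<boxplus> x) $ 3 = 0"
    using assms by (auto simp: hmul_def mem_tangent_plane field_simps)
  ultimately have "kaplan_gauge ((- y) \<boxplus> x) = root 4 (((norm (hproj (y - x)))\<^sup>2)\<^sup>2)"
    unfolding kaplan_gauge_def norm_hproj by (simp add: power2_commute)
  also have "\<dots> = root 4 (norm (hproj (y - x)) ^ 4)" by simp
  finally show ?thesis by (simp add: real_root_power_cancel)
qed

lemma omega_eq_norm_hproj:
  "omega \<Omega> x = (INF y \<in> frontier \<Omega> \<inter> tangent_plane x. norm (hproj (y - x)))"
  unfolding omega_def by (rule INF_cong) (auto simp: cc_dist_tangent_plane)

section \<open>The distance to the complement along a horizontal line\<close>

text \<open>If the whole line stays inside \<open>\<Omega>\<close>, then \<open>infdist\<close> has the default value 0; for bounded \<open>\<Omega>\<close> and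
  \<open>w \<noteq> 0\<close> this does not happen.\<close>

definition flow_dist :: "heis set \<Rightarrow> real \<times> real \<Rightarrow> heis \<Rightarrow> real" where
  "flow_dist \<Omega> w x = infdist 0 {s. x + s *\<^sub>R hfield w x \<notin> \<Omega>}"

lemma norm_le_norm_hfield: "norm w \<le> norm (hfield w x)"
proof -
  have "(norm w)\<^sup>2 \<le> (norm (hfield w x))\<^sup>2"
    by (simp add: norm_prod_def norm_vec_def L2_set_def sum_3)
  thus ?thesis by (simp add: power2_le_iff_abs_le)
qed

lemma bounded_flow_preimage:
  assumes "bounded \<Omega>" "w \<noteq> 0"
  shows "bounded {s. x + s *\<^sub>R hfield w x \<in> \<Omega>}"
proof -
  obtain B where B: "\<And>y. y \<in> \<Omega> \<Longrightarrow> norm y \<le> B" using assms(1) bounded_iff by blast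
  have "\<bar>s\<bar> \<le> (B + norm x) / norm w" if "x + s *\<^sub>R hfield w x \<in> \<Omega>" for s
  proof -
    have "\<bar>s\<bar> * norm w \<le> norm (s *\<^sub>R hfield w x)" by (simp add: norm_le_norm_hfield mult_left_mono)
    also have "\<dots> \<le> norm (x + s *\<^sub>R hfield w x) + norm x" 
      using norm_triangle_ineq4[of "x + s *\<^sub>R hfield w x" x] by simp
    also have "\<dots> \<le> B + norm x" using B[OF that] by simp
    finally show ?thesis using assms(2) by (simp add: field_simps)
  qed
  thus ?thesis by (auto simp: bounded_iff)
qed

lemma flow_exits:
  assumes "bounded \<Omega>" "w \<noteq> 0"
  shows "{s. x + s *\<^sub>R hfield w x \<notin> \<Omega>} \<noteq> {}"
proof
  assume "{s. x + s *\<^sub>R hfield w x \<notin> \<Omega>} = {}"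
  hence "{s. x + s *\<^sub>R hfield w x \<in> \<Omega>} = UNIV" by auto
  thus False using bounded_flow_preimage[OF assms, of x] not_bounded_UNIV by metis
qed

lemma continuous_on_hfield [continuous_intros]:
  "continuous_on A f \<Longrightarrow> continuous_on A g \<Longrightarrow> continuous_on A (\<lambda>z. hfield (f z) (g z))"
proof -
  have *: "hfield w x = fst w *\<^sub>R axis 1 1 + snd w *\<^sub>R axis 2 1
      + ((x$2 * fst w - x$1 * snd w) / 2) *\<^sub>R axis 3 1" for w x
    by (intro heis_eqI) (auto simp: axis_def)
  assume "continuous_on A f" "continuous_on A g"
  thus ?thesis unfolding * by (intro continuous_intros) auto
qed

lemma closed_flow_exits: "open \<Omega> \<Longrightarrow> closed {s. x + s *\<^sub>R hfield w x \<notin> \<Omega>}"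
proof -
  assume "open \<Omega>"
  have "continuous_on UNIV (\<lambda>s. x + s *\<^sub>R hfield w x)" by (intro continuous_intros)
  from closed_vimage[OF closed_Compl[OF \<open>open \<Omega>\<close>] this] show ?thesis by (simp add: vimage_def)
qed

lemma flow_dist_pos:
  assumes "open \<Omega>" "bounded \<Omega>" "w \<noteq> 0" "x \<in> \<Omega>"
  shows "0 < flow_dist \<Omega> w x"
  unfolding flow_dist_def
  using infdist_pos_not_in_closed[OF closed_flow_exits[OF assms(1)] flow_exits[OF assms(2,3)]] assms(4)
  by simp

lemma flow_dist_le_iff:
  assumes "open \<Omega>" "bounded \<Omega>" "w \<noteq> 0"
  shows "flow_dist \<Omega> w x \<le> r \<longleftrightarrow> (\<exists>s\<in>{-r..r}. x + s *\<^sub>R hfield w x \<notin> \<Omega>)"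
proof
  assume le: "flow_dist \<Omega> w x \<le> r"
  obtain s where "s \<in> {s. x + s *\<^sub>R hfield w x \<notin> \<Omega>}" "infdist 0 {s. x + s *\<^sub>R hfield w x \<notin> \<Omega>} = dist 0 s"
    using infdist_attains_inf[OF closed_flow_exits flow_exits] assms by metis
  thus "\<exists>s\<in>{-r..r}. x + s *\<^sub>R hfield w x \<notin> \<Omega>"
    using le by (auto simp: flow_dist_def intro!: bexI[of _ s])
next
  assume "\<exists>s\<in>{-r..r}. x + s *\<^sub>R hfield w x \<notin> \<Omega>"
  then obtain s where "s \<in> {-r..r}" and s: "x + s *\<^sub>R hfield w x \<notin> \<Omega>" by blast
  hence "\<bar>s\<bar> \<le> r" by auto
  thus "flow_dist \<Omega> w x \<le> r"
    unfolding flow_dist_def using infdist_le2[of s _ 0 r] s by simp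
qed

text \<open>On a fixed line the flow distance is the ordinary one-dimensional distance to the complement, which is
  the weight in the Hardy inequality on the real line.\<close>

lemma flow_dist_flow:
  "flow_dist \<Omega> w (x + t *\<^sub>R hfield w x) = infdist t (- {s. x + s *\<^sub>R hfield w x \<in> \<Omega>})"
proof -
  have *: "{s. x + t *\<^sub>R hfield w x + s *\<^sub>R hfield w (x + t *\<^sub>R hfield w x) \<notin> \<Omega>}
      = (\<lambda>s. s - t) ` (- {s. x + s *\<^sub>R hfield w x \<in> \<Omega>})"
  proof (intro equalityI subsetI)
    fix s assume "s \<in> {s. x + t *\<^sub>R hfield w x + s *\<^sub>R hfield w (x + t *\<^sub>R hfield w x) \<notin> \<Omega>}"
    thus "s \<in> (\<lambda>s. s - t) ` (- {s. x + s *\<^sub>R hfield w x \<in> \<Omega>})"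
      by (intro image_eqI[of _ _ "t + s"]) (auto simp: hfield_along_line algebra_simps)
  qed (auto simp: hfield_along_line algebra_simps)
  show ?thesis
    unfolding flow_dist_def * infdist_def by (auto simp: image_image dist_real_def abs_minus_commute)
qed

text \<open>Inside \<open>\<Omega>\<close> a sublevel set is the projection of a compact set of pairs \<open>(x, s)\<close> for which the flow has
  left \<open>\<Omega>\<close> at time \<open>s\<close>, and projections of compact sets are compact.\<close>

lemma flow_dist_borel_measurable:
  assumes "open \<Omega>" "bounded \<Omega>" "w \<noteq> 0"
  shows "flow_dist \<Omega> w \<in> borel_measurable borel"
  unfolding borel_measurable_iff_le
proof safe
  fix r
  have "compact ((closure \<Omega> \<times> {-r..r}) \<inter> (\<lambda>(x, s). x + s *\<^sub>R hfield w x) -` (- \<Omega>))"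
    using assms by (intro compact_Int_closed compact_Times closed_vimage)
      (auto simp: compact_closure case_prod_unfold intro!: continuous_intros)
  hence "compact (fst ` ((closure \<Omega> \<times> {-r..r}) \<inter> (\<lambda>(x, s). x + s *\<^sub>R hfield w x) -` (- \<Omega>)))"
    by (rule compact_continuous_image[OF continuous_on_fst[OF continuous_on_id]])
  hence "fst ` ((closure \<Omega> \<times> {-r..r}) \<inter> (\<lambda>(x, s). x + s *\<^sub>R hfield w x) -` (- \<Omega>)) \<in> sets borel"
    by (rule borel_compact)
  moreover have "{x. flow_dist \<Omega> w x \<le> r} = (if r < 0 then {} else - \<Omega> \<union>
      fst ` ((closure \<Omega> \<times> {-r..r}) \<inter> (\<lambda>(x, s). x + s *\<^sub>R hfield w x) -` (- \<Omega>)))"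
  proof (cases "r < 0")
    case False
    have "flow_dist \<Omega> w x \<le> r" if "x \<notin> \<Omega>" for x
      using that False by (subst flow_dist_le_iff[OF assms]) (auto intro!: bexI[of _ 0])
    thus ?thesis using False closure_subset[of \<Omega>]
      by (force simp: flow_dist_le_iff[OF assms])
  qed (auto simp: flow_dist_le_iff[OF assms])
  ultimately show "{w' \<in> space borel. flow_dist \<Omega> w w' \<le> r} \<in> sets borel"
    using assms by auto
qed

section \<open>Attainment and measurability of the boundary distance\<close>

lemma frontier_tangent_plane_nonempty:
  assumes "bounded \<Omega>" "x \<in> \<Omega>"
  shows "frontier \<Omega> \<inter> tangent_plane x \<noteq> {}"
proof -
  let ?f = "\<lambda>s. x + s *\<^sub>R hfield (1, 0) x"
  obtain s where s: "?f s \<notin> \<Omega>"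
    using flow_exits[OF assms(1), of "(1, 0)" x] by (auto simp: zero_prod_def)
  have "x \<in> range ?f" by (rule range_eqI[of _ _ 0]) simp
  hence "range ?f \<inter> \<Omega> \<noteq> {}" using assms(2) by blast
  moreover have "connected (range ?f)"
    by (intro connected_continuous_image continuous_intros convex_connected) auto
  moreover have "range ?f - \<Omega> \<noteq> {}" using s by auto
  ultimately have "range ?f \<inter> frontier \<Omega> \<noteq> {}" by (intro connected_Int_frontier)
  moreover have "range ?f \<subseteq> tangent_plane x"
    by (auto simp flip: hfield_scaleR intro: add_hfield_in_tangent_plane)
  ultimately show ?thesis by blast
qed

text \<open>The infimum is attained, because the frontier of a bounded set is compact and the tangent plane is closed.\<close>

lemma omega_le_iff:
  assumes "bounded \<Omega>" "x \<in> \<Omega>"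
  shows "omega \<Omega> x \<le> r \<longleftrightarrow> (\<exists>y \<in> frontier \<Omega> \<inter> tangent_plane x. norm (hproj (y - x)) \<le> r)"
proof -
  let ?A = "frontier \<Omega> \<inter> tangent_plane x"
  let ?\<rho> = "\<lambda>y. norm (hproj (y - x))"
  have "closed (tangent_plane x)"
    unfolding tangent_plane_def by (intro closed_Collect_eq continuous_intros)
  hence "compact ?A"
    using assms(1) by (intro compact_Int_closed) (auto simp: compact_frontier_bounded)
  moreover have "continuous_on ?A ?\<rho>"
    unfolding norm_hproj by (intro continuous_intros)
  ultimately obtain y where y: "y \<in> ?A" "\<And>z. z \<in> ?A \<Longrightarrow> ?\<rho> y \<le> ?\<rho> z"
    using continuous_attains_inf[OF _ frontier_tangent_plane_nonempty[OF assms]] by blast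
  have "omega \<Omega> x = ?\<rho> y"
    unfolding omega_eq_norm_hproj by (rule cInf_eq_minimum) (use y in auto)
  thus ?thesis using y by (auto intro: order_trans)
qed

text \<open>As for the flow distance, the sublevel sets are projections of compact sets. The indicator is there
  because nothing is known about \<open>omega\<close> outside \<open>\<Omega>\<close>, where the frontier may miss the tangent plane.\<close>

lemma omega_borel_measurable:
  assumes "open \<Omega>" "bounded \<Omega>"
  shows "(\<lambda>x. indicator \<Omega> x * omega \<Omega> x) \<in> borel_measurable borel"
  unfolding borel_measurable_iff_le
proof safe
  fix r
  let ?T = "{(x, y). y$3 - x$3 = (x$2 * (y$1 - x$1) - x$1 * (y$2 - x$2)) / 2
              \<and> norm (hproj (y - x)) \<le> r} :: (heis \<times> heis) set"
  have "closed ?T"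
    unfolding norm_hproj case_prod_unfold
    by (intro closed_Collect_conj closed_Collect_eq closed_Collect_le continuous_intros) auto
  hence "compact ((closure \<Omega> \<times> frontier \<Omega>) \<inter> ?T)"
    using assms by (intro compact_Int_closed compact_Times)
      (auto simp: compact_closure compact_frontier_bounded)
  hence "compact (fst ` ((closure \<Omega> \<times> frontier \<Omega>) \<inter> ?T))"
    by (rule compact_continuous_image[OF continuous_on_fst[OF continuous_on_id]])
  hence "fst ` ((closure \<Omega> \<times> frontier \<Omega>) \<inter> ?T) \<in> sets borel"
    by (rule borel_compact)
  moreover have "{x. indicator \<Omega> x * omega \<Omega> x \<le> r}
      = (\<Omega> \<inter> fst ` ((closure \<Omega> \<times> frontier \<Omega>) \<inter> ?T)) \<union> (if 0 \<le> r then - \<Omega> else {})"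
  proof (rule set_eqI)
    fix x
    show "x \<in> {x. indicator \<Omega> x * omega \<Omega> x \<le> r} \<longleftrightarrow>
       x \<in> (\<Omega> \<inter> fst ` ((closure \<Omega> \<times> frontier \<Omega>) \<inter> ?T)) \<union> (if 0 \<le> r then - \<Omega> else {})"
    proof (cases "x \<in> \<Omega>")
      case True
      thus ?thesis using omega_le_iff[OF assms(2) True, of r] closure_subset[of \<Omega>]
        by (force simp: mem_tangent_plane)
    qed auto
  qed
  ultimately show "{w \<in> space borel. indicator \<Omega> w * omega \<Omega> w \<le> r} \<in> sets borel"
    using assms by auto
qed

section \<open>Convex components and the two axis directions\<close>

text \<open>If \<open>\<bar>s\<bar>\<close> is smaller than the flow distance, the flow segment up to time \<open>s\<close> lies in \<open>\<Omega>\<close>; being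
  connected, it lies in the component of \<open>x\<close>, and therefore in every half-plane that contains the component.\<close>

lemma inner_mult_flow_dist_le:
  assumes \<Omega>: "open \<Omega>" "bounded \<Omega>" and "w \<noteq> 0" and x: "x \<in> \<Omega>"
    and l: "\<And>v. x + hfield v x \<in> connected_component_set (tangent_plane x \<inter> \<Omega>) x \<Longrightarrow> l \<bullet> v \<le> \<beta>"
  shows "\<bar>l \<bullet> w\<bar> * flow_dist \<Omega> w x \<le> \<beta>"
proof (rule ccontr)
  let ?C = "connected_component_set (tangent_plane x \<inter> \<Omega>) x"
  have x': "x \<in> tangent_plane x \<inter> \<Omega>" using x by (simp add: mem_tangent_plane)
  have "x \<in> ?C" using x' by simp
  moreover have "hfield 0 x = 0" by (intro heis_eqI) auto
  ultimately have "0 \<le> \<beta>" using l[of 0] by simp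
  assume "\<not> \<bar>l \<bullet> w\<bar> * flow_dist \<Omega> w x \<le> \<beta>"
  hence gt: "\<beta> < \<bar>l \<bullet> w\<bar> * flow_dist \<Omega> w x" by simp
  hence lw: "0 < \<bar>l \<bullet> w\<bar>" using \<open>0 \<le> \<beta>\<close> by (cases "l \<bullet> w = 0") auto
  obtain s where s: "\<beta> / \<bar>l \<bullet> w\<bar> < s" "s < flow_dist \<Omega> w x"
    using dense[of "\<beta> / \<bar>l \<bullet> w\<bar>" "flow_dist \<Omega> w x"] gt lw by (auto simp: field_simps)
  have in\<Omega>: "x + t *\<^sub>R hfield w x \<in> \<Omega>" if "\<bar>t\<bar> \<le> s" for t
    using flow_dist_le_iff[OF \<Omega> \<open>w \<noteq> 0\<close>, of x s] s that by (auto simp: abs_le_iff)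
  let ?I = "(\<lambda>t. x + t *\<^sub>R hfield w x) ` {-s..s}"
  have "0 \<le> s" using s \<open>0 \<le> \<beta>\<close> lw by (smt (verit) divide_nonneg_pos)
  have "connected ?I" by (intro connected_continuous_image continuous_intros) auto
  moreover have "x \<in> ?I" using \<open>0 \<le> s\<close> by (auto intro!: image_eqI[of _ _ 0])
  moreover have "?I \<subseteq> tangent_plane x \<inter> \<Omega>"
    using in\<Omega> by (auto simp: abs_le_iff add_hfield_in_tangent_plane simp flip: hfield_scaleR)
  ultimately have "?I \<subseteq> ?C" by (intro connected_component_maximal)
  hence inC: "x + t *\<^sub>R hfield w x \<in> ?C" if "\<bar>t\<bar> \<le> s" for t
    using that by (blast intro: abs_le_D1 abs_le_D2 minus_le_iff[THEN iffD1] atLeastAtMost_iff[THEN iffD2])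
  have "l \<bullet> (t *\<^sub>R w) \<le> \<beta>" if "\<bar>t\<bar> \<le> s" for t
    by (rule l, unfold hfield_scaleR, rule inC[OF that])
  from this[of s] this[of "-s"] have "s * \<bar>l \<bullet> w\<bar> \<le> \<beta>" using \<open>0 \<le> s\<close> by (auto simp: abs_if)
  thus False using s(1) lw by (simp add: field_simps)
qed

text \<open>Separation takes place in the coordinates \<open>v \<mapsto> x + hfield v x\<close> of the tangent plane. A separating
  functional on the ambient space could be constant on that plane, and would then say nothing.\<close>

lemma inverse_dist_sq_le:
  assumes \<Omega>: "open \<Omega>" "bounded \<Omega>" and x: "x \<in> \<Omega>"
    and conv: "convex (connected_component_set (tangent_plane x \<inter> \<Omega>) x)"
    and y: "y \<in> tangent_plane x" "y \<notin> \<Omega>"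
  shows "0 < norm (hproj (y - x))"
    and "1 / (norm (hproj (y - x)))\<^sup>2
            \<le> 1 / (flow_dist \<Omega> (1, 0) x)\<^sup>2 + 1 / (flow_dist \<Omega> (0, 1) x)\<^sup>2"
proof -
  let ?C = "connected_component_set (tangent_plane x \<inter> \<Omega>) x"
  let ?w = "hproj (y - x)"
  have hfield0: "hfield 0 x = 0" by (intro heis_eqI) auto
  define D where "D = {v. x + hfield v x \<in> ?C}"
  have "convex D"
  proof (rule convexI)
    fix v1 v2 and a b :: real
    assume v: "v1 \<in> D" "v2 \<in> D" and ab: "0 \<le> a" "0 \<le> b" "a + b = 1"
    have "x + hfield (a *\<^sub>R v1 + b *\<^sub>R v2) x = (a + b) *\<^sub>R x + hfield (a *\<^sub>R v1 + b *\<^sub>R v2) x" 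
      using ab by simp
    also have "\<dots> = a *\<^sub>R (x + hfield v1 x) + b *\<^sub>R (x + hfield v2 x)"
      by (intro heis_eqI) (auto simp: algebra_simps add_divide_distrib diff_divide_distrib)
    also have "\<dots> \<in> ?C" using v ab by (intro convexD[OF conv]) (auto simp: D_def)
    finally show "a *\<^sub>R v1 + b *\<^sub>R v2 \<in> D" by (simp add: D_def)
  qed
  have 0: "0 \<in> D" using x by (auto simp: D_def hfield0 mem_tangent_plane)
  have "?C \<subseteq> \<Omega>" using connected_component_subset[of "tangent_plane x \<inter> \<Omega>" x] by blast
  hence w: "?w \<notin> D" using y(2) add_hfield_hproj[OF y(1)] by (auto simp: D_def)
  show pos: "0 < norm ?w" using 0 w by auto
  obtain l b where l: "l \<noteq> 0" "\<And>v. v \<in> D \<Longrightarrow> l \<bullet> v \<le> b" "b \<le> l \<bullet> ?w"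
  proof -
    have "\<exists>l b. l \<noteq> 0 \<and> (\<forall>v\<in>D. l \<bullet> v \<le> b) \<and> (\<forall>v\<in>{?w}. b \<le> l \<bullet> v)"
      by (rule separating_hyperplane_sets) (use \<open>convex D\<close> 0 w in auto)
    thus ?thesis using that by blast
  qed
  have bound: "(l \<bullet> e)\<^sup>2 / ((norm l)\<^sup>2 * (norm ?w)\<^sup>2) \<le> 1 / (flow_dist \<Omega> e x)\<^sup>2" if "e \<noteq> 0" for e
  proof -
    have "\<bar>l \<bullet> e\<bar> * flow_dist \<Omega> e x \<le> l \<bullet> ?w"
      by (rule inner_mult_flow_dist_le[OF \<Omega> that x]) (use l D_def in force)
    also have "\<dots> \<le> norm l * norm ?w" by (rule norm_cauchy_schwarz)
    finally have "(\<bar>l \<bullet> e\<bar> * flow_dist \<Omega> e x)\<^sup>2 \<le> (norm l * norm ?w)\<^sup>2"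
      using flow_dist_pos[OF \<Omega> that x] by (intro power_mono) auto
    thus ?thesis using flow_dist_pos[OF \<Omega> that x] pos l(1) by (simp add: field_simps power_mult_distrib)
  qed
  \<comment> \<open>Pythagoras for the normal \<open>l\<close> combines the two axis bounds into exactly \<open>1 / \<rho>\<^sup>2\<close>.\<close>
  have "(norm l)\<^sup>2 = (l \<bullet> (1, 0))\<^sup>2 + (l \<bullet> (0, 1))\<^sup>2"
    by (simp add: norm_prod_def inner_prod_def)
  moreover have "1 / (norm ?w)\<^sup>2 = (norm l)\<^sup>2 / ((norm l)\<^sup>2 * (norm ?w)\<^sup>2)" using l(1) by simp
  ultimately have "1 / (norm ?w)\<^sup>2 = ((l \<bullet> (1, 0))\<^sup>2 + (l \<bullet> (0, 1))\<^sup>2) / ((norm l)\<^sup>2 * (norm ?w)\<^sup>2)"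
    by (simp only:)
  also have "\<dots> \<le> 1 / (flow_dist \<Omega> (1, 0) x)\<^sup>2 + 1 / (flow_dist \<Omega> (0, 1) x)\<^sup>2"
    unfolding add_divide_distrib by (intro add_mono bound) (auto simp: zero_prod_def)
  finally show "1 / (norm ?w)\<^sup>2 \<le> 1 / (flow_dist \<Omega> (1, 0) x)\<^sup>2 + 1 / (flow_dist \<Omega> (0, 1) x)\<^sup>2" .
qed

lemma inverse_omega_sq_le:
  assumes \<Omega>: "open \<Omega>" "bounded \<Omega>" and x: "x \<in> \<Omega>"
    and conv: "convex (connected_component_set (tangent_plane x \<inter> \<Omega>) x)"
  shows "1 / (omega \<Omega> x)\<^sup>2 \<le> 1 / (flow_dist \<Omega> (1, 0) x)\<^sup>2 + 1 / (flow_dist \<Omega> (0, 1) x)\<^sup>2"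
proof -
  obtain y where y: "y \<in> frontier \<Omega> \<inter> tangent_plane x" "norm (hproj (y - x)) \<le> omega \<Omega> x"
    using omega_le_iff[OF \<Omega>(2) x] by blast
  have "y \<notin> \<Omega>" using y(1) \<Omega>(1) by (auto simp: frontier_def interior_open)
  note * = inverse_dist_sq_le[OF \<Omega> x conv _ this]
  have "1 / (omega \<Omega> x)\<^sup>2 \<le> 1 / (norm (hproj (y - x)))\<^sup>2"
    using *(1) y by (intro divide_left_mono power_mono mult_pos_pos) auto
  thus ?thesis using *(2) y(1) by auto
qed

section \<open>The Hardy inequality on bounded open subsets of the line\<close>

text \<open>With \<open>k = 1 / (t - e)\<close> the square \<open>\<bar>2 g' - k g\<bar>\<^sup>2\<close> equals \<open>4 \<bar>g'\<bar>\<^sup>2 - k\<^sup>2 \<bar>g\<bar>\<^sup>2 - 2 (k \<bar>g\<bar>\<^sup>2)'\<close>; integrate.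
  Taking for \<open>e\<close> the left or the right end of an interval makes the boundary term at its midpoint
  nonpositive on the right-hand side.\<close>

lemma hardy_away_from_endpoint:
  fixes g g' :: "real \<Rightarrow> 'a::euclidean_space"
  assumes cd: "c \<le> d" and e: "e \<notin> {c..d}"
    and der: "\<And>t. (g has_vector_derivative g' t) (at t)"
    and cont: "continuous_on UNIV g'"
  shows "integral {c..d} (\<lambda>t. (norm (g t))\<^sup>2 / (t - e)\<^sup>2)
           \<le> 4 * integral {c..d} (\<lambda>t. (norm (g' t))\<^sup>2)
             - 2 * ((norm (g d))\<^sup>2 / (d - e) - (norm (g c))\<^sup>2 / (c - e))"
proof -
  have gcont: "continuous_on UNIV g"
    using der continuous_on_vector_derivative has_vector_derivative_at_within by blast
  note conts = continuous_on_subset[OF gcont subset_UNIV] continuous_on_subset[OF cont subset_UNIV]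
  have ne: "t - e \<noteq> 0" if "t \<in> {c..d}" for t using e that by auto
  define H where "H t = (norm (g t))\<^sup>2 / (t - e)" for t
  define H' where "H' t = 2 * (g t \<bullet> g' t) / (t - e) - (norm (g t))\<^sup>2 / (t - e)\<^sup>2" for t
  have "(H' has_integral H d - H c) {c..d}"
  proof (rule fundamental_theorem_of_calculus[OF cd])
    fix t assume t: "t \<in> {c..d}"
    have "(g has_derivative (\<lambda>h. h *\<^sub>R g' t)) (at t within {c..d})"
      using der[of t] has_vector_derivative_at_within has_vector_derivative_def by blast
    from has_derivative_inner[OF this this]
    have *: "((\<lambda>t. (norm (g t))\<^sup>2) has_real_derivative 2 * (g t \<bullet> g' t)) (at t within {c..d})"
      unfolding has_field_derivative_def power2_norm_eq_inner
      by (rule has_derivative_eq_rhs) (auto simp: inner_commute algebra_simps)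
    have "(H has_real_derivative
        (2 * (g t \<bullet> g' t) * (t - e) - (norm (g t))\<^sup>2 * 1) / ((t - e) * (t - e))) (at t within {c..d})"
      unfolding H_def[abs_def] using ne[OF t] by (intro DERIV_divide *) (auto intro!: derivative_eq_intros)
    also have "(2 * (g t \<bullet> g' t) * (t - e) - (norm (g t))\<^sup>2 * 1) / ((t - e) * (t - e)) = H' t"
      using ne[OF t] by (simp add: H'_def diff_divide_distrib power2_eq_square)
    finally have "(H has_real_derivative H' t) (at t within {c..d})" .
    thus "(H has_vector_derivative H' t) (at t within {c..d})"
      by (simp add: has_real_derivative_iff_has_vector_derivative)
  qed
  moreover have "((\<lambda>t. 4 * (norm (g' t))\<^sup>2) has_integral 4 * integral {c..d} (\<lambda>t. (norm (g' t))\<^sup>2)) {c..d}"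
    by (intro has_integral_mult_right integrable_integral integrable_continuous_interval
          continuous_intros conts)
  ultimately have R: "((\<lambda>t. 4 * (norm (g' t))\<^sup>2 - 2 * H' t) has_integral
      4 * integral {c..d} (\<lambda>t. (norm (g' t))\<^sup>2) - 2 * (H d - H c)) {c..d}"
    by (intro has_integral_diff has_integral_mult_right[of H'])
  have L: "(\<lambda>t. (norm (g t))\<^sup>2 / (t - e)\<^sup>2) integrable_on {c..d}"
    by (intro integrable_continuous_interval continuous_intros conts) (use ne in auto)
  have "integral {c..d} (\<lambda>t. (norm (g t))\<^sup>2 / (t - e)\<^sup>2)
      \<le> 4 * integral {c..d} (\<lambda>t. (norm (g' t))\<^sup>2) - 2 * (H d - H c)"
  proof (rule has_integral_le[OF integrable_integral[OF L] R])
    fix t assume t: "t \<in> {c..d}"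
    define k where "k = 1 / (t - e)"
    have "0 \<le> (norm (2 *\<^sub>R g' t - k *\<^sub>R g t))\<^sup>2" by simp
    also have "\<dots> = 4 * (norm (g' t))\<^sup>2 - 2 * (2 * (g t \<bullet> g' t) * k - (norm (g t))\<^sup>2 * k\<^sup>2) - (norm (g t))\<^sup>2 * k\<^sup>2"
      unfolding power2_norm_eq_inner
      by (simp add: inner_diff_left inner_diff_right inner_commute power2_eq_square algebra_simps)
    also have "\<dots> = 4 * (norm (g' t))\<^sup>2 - 2 * H' t - (norm (g t))\<^sup>2 / (t - e)\<^sup>2"
      by (simp add: H'_def k_def power_one_over)
    finally show "(norm (g t))\<^sup>2 / (t - e)\<^sup>2 \<le> 4 * (norm (g' t))\<^sup>2 - 2 * H' t" by simp
  qed
  thus ?thesis by (simp add: H_def)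
qed

text \<open>The distance to the end points is \<open>t - a\<close> on the left half and \<open>b - t\<close> on the right half. On each half
  the previous inequality is used with the nearer end point; the boundary terms at the ends vanish since
  \<open>g\<close> vanishes near \<open>a\<close> and \<open>b\<close>, and those at the midpoint have the good sign.\<close>

lemma hardy_interval:
  fixes g g' :: "real \<Rightarrow> 'a::euclidean_space"
  assumes "a < b"
    and der: "\<And>t. (g has_vector_derivative g' t) (at t)"
    and cont: "continuous_on UNIV g'"
    and supp: "a \<notin> closure {t. g t \<noteq> 0}" "b \<notin> closure {t. g t \<noteq> 0}"
  shows "(\<integral>\<^sup>+t\<in>{a<..<b}. ennreal ((norm (g t))\<^sup>2 / (min (t - a) (b - t))\<^sup>2) \<partial>lborel)
           \<le> 4 * (\<integral>\<^sup>+t\<in>{a<..<b}. ennreal ((norm (g' t))\<^sup>2) \<partial>lborel)"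
proof -
  have gcont: "continuous_on UNIV g"
    using der continuous_on_vector_derivative has_vector_derivative_at_within by blast
  note conts = continuous_on_subset[OF gcont subset_UNIV] continuous_on_subset[OF cont subset_UNIV]
  have [measurable]: "g \<in> borel_measurable borel" "g' \<in> borel_measurable borel"
    using gcont cont by (auto intro: borel_measurable_continuous_onI)
  let ?Z = "- closure {t. g t \<noteq> 0}"
  have Z: "open ?Z" "a \<in> ?Z" "b \<in> ?Z" using supp by auto
  have gZ: "g t = 0" if "t \<in> ?Z" for t using that closure_subset[of "{t. g t \<noteq> 0}"] by auto
  obtain r1 where r1: "r1 > 0" "ball a r1 \<subseteq> ?Z" using Z openE by blast
  obtain r2 where r2: "r2 > 0" "ball b r2 \<subseteq> ?Z" using Z openE by blast
  define m where "m = (a + b) / 2"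
  \<comment> \<open>\<open>g\<close> vanishes within distance \<open>r\<close> of both end points, and \<open>r\<close> is too small to reach the midpoint.\<close>
  define r where "r = Min {r1 / 2, r2 / 2, (m - a) / 2}"
  have r: "0 < r" "r < r1" "r < r2" "a + r < m" "m < b - r"
    using r1(1) r2(1) \<open>a < b\<close> by (auto simp: r_def m_def min_def field_simps split: if_splits)
  have za: "g t = 0" if "t \<in> {a..a+r}" for t
    by (rule gZ, rule subsetD[OF r1(2)]) (use that r in \<open>auto simp: dist_real_def\<close>)
  have zb: "g t = 0" if "t \<in> {b-r..b}" for t
    by (rule gZ, rule subsetD[OF r2(2)]) (use that r in \<open>auto simp: dist_real_def\<close>)
  let ?f = "\<lambda>t. (norm (g t))\<^sup>2 / (min (t - a) (b - t))\<^sup>2"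
  have cf: "continuous_on {a+r..b-r} ?f"
    by (intro continuous_intros conts) (use r in auto)
  have cg: "continuous_on {a+r..b-r} (\<lambda>t. (norm (g' t))\<^sup>2)"
    by (intro continuous_intros conts)
  have if': "?f integrable_on {a+r..b-r}" "(\<lambda>t. (norm (g' t))\<^sup>2) integrable_on {a+r..b-r}"
    using cf cg by (auto intro: integrable_continuous_interval)
  have "integral {a+r..b-r} ?f = integral {a+r..m} ?f + integral {m..b-r} ?f"
    by (rule Henstock_Kurzweil_Integration.integral_combine[symmetric]) (use r if' in auto)
  also have "integral {a+r..m} ?f = integral {a+r..m} (\<lambda>t. (norm (g t))\<^sup>2 / (t - a)\<^sup>2)"
    by (rule integral_cong) (auto simp: m_def min_def)
  also have "\<dots> \<le> 4 * integral {a+r..m} (\<lambda>t. (norm (g' t))\<^sup>2)"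
  proof -
    define q where "q = (norm (g m))\<^sup>2 / (m - a)"
    have "integral {a+r..m} (\<lambda>t. (norm (g t))\<^sup>2 / (t - a)\<^sup>2)
        \<le> 4 * integral {a+r..m} (\<lambda>t. (norm (g' t))\<^sup>2) - 2 * (q - (norm (g (a + r)))\<^sup>2 / (a + r - a))"
      unfolding q_def by (rule hardy_away_from_endpoint[OF _ _ der cont]) (use r in auto)
    moreover have "0 \<le> q" "g (a + r) = 0" using r za[of "a + r"] by (auto simp: q_def)
    ultimately show ?thesis by simp
  qed
  also have "integral {m..b-r} ?f = integral {m..b-r} (\<lambda>t. (norm (g t))\<^sup>2 / (t - b)\<^sup>2)"
  proof (rule integral_cong)
    fix t assume "t \<in> {m..b-r}"
    hence "min (t - a) (b - t) = b - t" by (auto simp: m_def)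
    thus "?f t = (norm (g t))\<^sup>2 / (t - b)\<^sup>2" by (simp add: power2_commute)
  qed
  also have "\<dots> \<le> 4 * integral {m..b-r} (\<lambda>t. (norm (g' t))\<^sup>2)"
  proof -
    define q where "q = (norm (g m))\<^sup>2 / (m - b)"
    have "integral {m..b-r} (\<lambda>t. (norm (g t))\<^sup>2 / (t - b)\<^sup>2)
        \<le> 4 * integral {m..b-r} (\<lambda>t. (norm (g' t))\<^sup>2) - 2 * ((norm (g (b - r)))\<^sup>2 / (b - r - b) - q)"
      unfolding q_def by (rule hardy_away_from_endpoint[OF _ _ der cont]) (use r in auto)
    moreover have "q \<le> 0" "g (b - r) = 0" using r zb[of "b - r"] by (auto simp: q_def divide_nonneg_neg)
    ultimately show ?thesis by simp
  qed
  also have "4 * integral {a+r..m} (\<lambda>t. (norm (g' t))\<^sup>2) + 4 * integral {m..b-r} (\<lambda>t. (norm (g' t))\<^sup>2)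
      = 4 * integral {a+r..b-r} (\<lambda>t. (norm (g' t))\<^sup>2)"
    using Henstock_Kurzweil_Integration.integral_combine[of "a+r" m "b-r" "\<lambda>t. (norm (g' t))\<^sup>2"] r if'
    by (simp flip: distrib_left)
  finally have main: "integral {a+r..b-r} ?f \<le> 4 * integral {a+r..b-r} (\<lambda>t. (norm (g' t))\<^sup>2)"
    by simp
  have nn: "(\<integral>\<^sup>+t\<in>{a+r..b-r}. ennreal (h t) \<partial>lborel) = ennreal (integral {a+r..b-r} h)"
    if "continuous_on {a+r..b-r} h" "\<And>t. 0 \<le> h t" "h \<in> borel_measurable borel" for h :: "real \<Rightarrow> real"
  proof -
    have "(h has_integral integral {a+r..b-r} h) {a+r..b-r}"
      using that(1) by (intro integrable_integral integrable_continuous_interval)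
    hence "((\<lambda>t. if t \<in> {a+r..b-r} then h t else 0) has_integral integral {a+r..b-r} h) UNIV"
      by (simp only: has_integral_restrict_UNIV)
    hence "(\<integral>\<^sup>+t. ennreal (if t \<in> {a+r..b-r} then h t else 0) \<partial>lborel) = ennreal (integral {a+r..b-r} h)"
      using that(2,3) by (intro nn_integral_has_integral_lborel) auto
    moreover have "(\<integral>\<^sup>+t\<in>{a+r..b-r}. ennreal (h t) \<partial>lborel)
        = (\<integral>\<^sup>+t. ennreal (if t \<in> {a+r..b-r} then h t else 0) \<partial>lborel)"
      by (rule nn_integral_cong) (simp add: indicator_def)
    ultimately show ?thesis by simp
  qed
  have "(\<integral>\<^sup>+t\<in>{a<..<b}. ennreal (?f t) \<partial>lborel) = (\<integral>\<^sup>+t\<in>{a+r..b-r}. ennreal (?f t) \<partial>lborel)"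
    by (rule nn_integral_cong) (use za zb r in \<open>auto simp: indicator_def\<close>)
  also have "\<dots> = ennreal (integral {a+r..b-r} ?f)"
    by (rule nn[OF cf]) auto
  also have "\<dots> \<le> ennreal (4 * integral {a+r..b-r} (\<lambda>t. (norm (g' t))\<^sup>2))"
    by (rule ennreal_leI[OF main])
  also have "\<dots> = 4 * (\<integral>\<^sup>+t\<in>{a+r..b-r}. ennreal ((norm (g' t))\<^sup>2) \<partial>lborel)"
    by (subst nn[OF cg]) (auto simp: ennreal_mult' )
  also have "\<dots> \<le> 4 * (\<integral>\<^sup>+t\<in>{a<..<b}. ennreal ((norm (g' t))\<^sup>2) \<partial>lborel)"
    by (intro mult_left_mono nn_integral_mono) (use r in \<open>auto simp: indicator_def\<close>)
  finally show ?thesis .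
qed

text \<open>The compact support meets finitely many components of \<open>S\<close> only. They are bounded open intervals whose
  end points lie outside \<open>S\<close>, and on each of them the distance to the complement of \<open>S\<close> is at least
  the distance to its end points, so the interval inequalities can be summed.\<close>

lemma hardy_open_real:
  fixes g g' :: "real \<Rightarrow> 'a::euclidean_space"
  assumes S: "open S" "bounded S"
    and der: "\<And>t. (g has_vector_derivative g' t) (at t)"
    and cont: "continuous_on UNIV g'"
    and supp: "compact (closure {t. g t \<noteq> 0})" "closure {t. g t \<noteq> 0} \<subseteq> S"
  shows "(\<integral>\<^sup>+t. ennreal ((norm (g t))\<^sup>2 / (infdist t (- S))\<^sup>2) \<partial>lborel)
           \<le> 4 * (\<integral>\<^sup>+t. ennreal ((norm (g' t))\<^sup>2) \<partial>lborel)"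
proof -
  let ?K = "closure {t. g t \<noteq> 0}"
  let ?f = "\<lambda>t. ennreal ((norm (g t))\<^sup>2 / (infdist t (- S))\<^sup>2)"
  let ?h = "\<lambda>t. ennreal ((norm (g' t))\<^sup>2)"
  have gcont: "continuous_on UNIV g"
    using der continuous_on_vector_derivative has_vector_derivative_at_within by blast
  have [measurable]: "g \<in> borel_measurable borel" "g' \<in> borel_measurable borel"
    "(\<lambda>t. infdist t (- S)) \<in> borel_measurable borel"
    using gcont cont by (auto intro!: borel_measurable_continuous_onI continuous_intros)
  obtain D where D: "D \<subseteq> components S" "finite D" "?K \<subseteq> \<Union>D"
  proof (rule compactE[OF supp(1), of "components S"])
    show "?K \<subseteq> \<Union> (components S)" using supp(2) Union_components[of S] by simp
  qed (use open_components[OF S(1)] in auto)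
  have [measurable]: "C \<in> sets borel" if "C \<in> D" for C
    using that D open_components[OF S(1)] by auto
  have disj: "(\<Sum>C\<in>D. indicator C t) \<le> (1::ennreal)" for t
  proof (cases "\<exists>C\<in>D. t \<in> C")
    case True
    then obtain C where C: "C \<in> D" "t \<in> C" by blast
    have "t \<notin> C'" if "C' \<in> D - {C}" for C'
      
    proof -
      have "C \<inter> C' = {}" using that C D components_nonoverlap[of C S C'] by auto
      thus ?thesis using C by blast
    qed
    hence "(\<Sum>C\<in>D. indicator C t) = (\<Sum>C\<in>{C}. indicator C t :: ennreal)"
      using C D by (intro sum.mono_neutral_right) (auto simp: indicator_def)
    thus ?thesis using C by simp
  qed (simp add: indicator_def)
  have comp: "(\<integral>\<^sup>+t\<in>C. ?f t \<partial>lborel) \<le> 4 * (\<integral>\<^sup>+t\<in>C. ?h t \<partial>lborel)" if "C \<in> D" for C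
  proof -
    have C: "C \<in> components S" using that D by blast
    have "C \<subseteq> S" by (rule in_components_subset[OF C])
    have "C \<noteq> {}" by (rule in_components_nonempty[OF C])
    have "open C" by (rule open_components[OF S(1) C])
    have "connected C" by (rule in_components_connected[OF C])
    have bdd: "bdd_above C" "bdd_below C"
      by (rule bounded_imp_bdd_above[OF bounded_subset[OF S(2) \<open>C \<subseteq> S\<close>]],
          rule bounded_imp_bdd_below[OF bounded_subset[OF S(2) \<open>C \<subseteq> S\<close>]])
    define a b where "a = Inf C" and "b = Sup C"
    have lt: "a < t" "t < b" if t: "t \<in> C" for t
    proof -
      obtain e where e: "e > 0" "ball t e \<subseteq> C" by (rule openE[OF \<open>open C\<close> t])
      have "t - e/2 \<in> C" "t + e/2 \<in> C"
        by (rule subsetD[OF e(2)], use e(1) in \<open>simp add: dist_real_def abs_if\<close>)+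
      hence "a \<le> t - e/2" "t + e/2 \<le> b"
        unfolding a_def b_def by (simp_all only: cInf_lower[OF _ bdd(2)] cSup_upper[OF _ bdd(1)])
      thus "a < t" "t < b" using e(1) by linarith+
    qed
    have Ceq: "C = {a<..<b}"
    proof (intro equalityI subsetI)
      fix t assume "t \<in> {a<..<b}"
      hence "Inf C < t" "t < Sup C" by (auto simp: a_def b_def)
      then obtain s1 s2 where "s1 \<in> C" "s1 < t" "s2 \<in> C" "t < s2"
        using cInf_lessD[OF \<open>C \<noteq> {}\<close>, of t] less_cSupD[OF \<open>C \<noteq> {}\<close>, of t] by auto
      thus "t \<in> C" using connectedD_interval[OF \<open>connected C\<close>, of s1 s2 t] by simp
    qed (use lt in auto)
    obtain c where "c \<in> C" using \<open>C \<noteq> {}\<close> by blast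
    hence "a < b" using lt[of c] by linarith
    \<comment> \<open>An end point in \<open>S\<close> could be added to \<open>C\<close> without losing connectedness.\<close>
    have notin: "a \<notin> S \<and> b \<notin> S"
    proof -
      have "x \<notin> S" if x: "x \<in> {a, b}" for x
      proof
        assume "x \<in> S"
        have "x \<in> closure C" using x \<open>a < b\<close> unfolding Ceq by auto
        hence "connected (insert x C)"
          by (intro connected_intermediate_closure[OF \<open>connected C\<close>]) (use closure_subset[of C] \<open>x \<in> closure C\<close> in auto)
        hence "insert x C \<subseteq> C"
          using \<open>x \<in> S\<close> \<open>C \<subseteq> S\<close> \<open>C \<noteq> {}\<close> by (intro components_maximal[OF C]) auto
        thus False using x unfolding Ceq by auto
      qed
      thus ?thesis by auto
    qed
    have le: "min (t - a) (b - t) \<le> infdist t (- S)" if "t \<in> C" for t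
    proof -
      have "min (t - a) (b - t) \<le> dist t s" if "s \<in> - S" for s
      proof -
        have "s \<notin> C" using that \<open>C \<subseteq> S\<close> by auto
        thus ?thesis using \<open>t \<in> C\<close> unfolding Ceq dist_real_def by auto
      qed
      thus ?thesis using notin by (auto simp: infdist_def intro!: cINF_greatest)
    qed
    have "(\<integral>\<^sup>+t\<in>C. ?f t \<partial>lborel)
        \<le> (\<integral>\<^sup>+t\<in>C. ennreal ((norm (g t))\<^sup>2 / (min (t - a) (b - t))\<^sup>2) \<partial>lborel)"
    proof (rule nn_integral_mono)
      fix t
      show "?f t * indicator C t \<le> ennreal ((norm (g t))\<^sup>2 / (min (t - a) (b - t))\<^sup>2) * indicator C t"
      proof (cases "t \<in> C")
        case True
        hence "0 < min (t - a) (b - t)" using lt by auto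
        moreover from this have "0 < infdist t (- S)" using le[OF True] by linarith
        moreover have "(min (t - a) (b - t))\<^sup>2 \<le> (infdist t (- S))\<^sup>2"
          by (rule power_mono[OF le[OF True]]) (use calculation in linarith)
        ultimately have "(norm (g t))\<^sup>2 / (infdist t (- S))\<^sup>2 \<le> (norm (g t))\<^sup>2 / (min (t - a) (b - t))\<^sup>2"
          by (intro divide_left_mono mult_pos_pos zero_less_power zero_le_power2)
        thus ?thesis using True by (simp add: ennreal_leI)
      qed auto
    qed
    also have "\<dots> \<le> 4 * (\<integral>\<^sup>+t\<in>C. ?h t \<partial>lborel)"
      unfolding Ceq using notin supp by (intro hardy_interval[OF \<open>a < b\<close> der cont]) auto
    finally show ?thesis .
  qed
  have "(\<integral>\<^sup>+t. ?f t \<partial>lborel) \<le> (\<integral>\<^sup>+t. (\<Sum>C\<in>D. ?f t * indicator C t) \<partial>lborel)"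
  proof (rule nn_integral_mono)
    fix t
    show "?f t \<le> (\<Sum>C\<in>D. ?f t * indicator C t)"
    proof (cases "g t = 0")
      case False
      hence "t \<in> ?K" using closure_subset[of "{t. g t \<noteq> 0}"] by auto
      then obtain C where "C \<in> D" "t \<in> C" using D by blast
      have "?f t = ?f t * indicator C t" using \<open>t \<in> C\<close> by simp
      also have "\<dots> \<le> (\<Sum>C\<in>D. ?f t * indicator C t)"
        by (rule member_le_sum[OF \<open>C \<in> D\<close> _ D(2)]) simp
      finally show ?thesis .
    qed auto
  qed
  also have "\<dots> = (\<Sum>C\<in>D. \<integral>\<^sup>+t\<in>C. ?f t \<partial>lborel)"
    by (rule nn_integral_sum) auto
  also have "\<dots> \<le> (\<Sum>C\<in>D. 4 * (\<integral>\<^sup>+t\<in>C. ?h t \<partial>lborel))"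
    by (rule sum_mono[OF comp])
  also have "\<dots> = 4 * (\<integral>\<^sup>+t. (\<Sum>C\<in>D. ?h t * indicator C t) \<partial>lborel)"
    by (subst nn_integral_sum) (auto simp: sum_distrib_left)
  also have "\<dots> \<le> 4 * (\<integral>\<^sup>+t. ?h t \<partial>lborel)"
  proof (intro mult_left_mono nn_integral_mono)
    show "(\<Sum>C\<in>D. ?h t * indicator C t) \<le> ?h t" for t
      using mult_left_mono[OF disj[of t], of "?h t"] by (simp add: sum_distrib_left)
  qed simp
  finally show ?thesis .
qed

section \<open>Integration along horizontal lines\<close>

text \<open>The time-\<open>t\<close> flow is a translation composed with a linear shear of determinant 1.\<close>

lemma distr_lborel_flow:
  "distr lborel borel (\<lambda>x. x + t *\<^sub>R hfield w x) = lborel"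
proof (rule lborel_eqI[symmetric])
  let ?T = "\<lambda>t x. x + t *\<^sub>R hfield w x"
  have [measurable]: "?T t \<in> borel_measurable borel"
    by (intro borel_measurable_continuous_onI continuous_intros)
  fix l u :: heis assume lu: "\<And>b. b \<in> Basis \<Longrightarrow> l \<bullet> b \<le> u \<bullet> b"
  define A where "A x = x - t *\<^sub>R (hfield w x - hfield w 0)" for x
  have "linear A"
    by (intro linearI heis_eqI) (auto simp: A_def algebra_simps add_divide_distrib diff_divide_distrib)
  have "det (matrix A) = 1"
    by (simp add: det_3 matrix_def A_def axis_def)
  have inv: "?T t -` box l u = (+) (- t *\<^sub>R hfield w 0) ` (A ` box l u)"
  proof (intro equalityI subsetI)
    fix x assume "x \<in> ?T t -` box l u"
    moreover have "x = - t *\<^sub>R hfield w 0 + A (?T t x)"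
      by (simp add: A_def hfield_along_line algebra_simps)
    ultimately show "x \<in> (+) (- t *\<^sub>R hfield w 0) ` (A ` box l u)" by blast
  next
    fix x assume "x \<in> (+) (- t *\<^sub>R hfield w 0) ` (A ` box l u)"
    then obtain y where y: "y \<in> box l u" "x = ?T (- t) y"
      by (auto simp: A_def algebra_simps)
    have "?T t x = (y + (- t) *\<^sub>R hfield w y) + t *\<^sub>R hfield w y" by (simp only: y(2) hfield_along_line)
    hence "?T t x = y" by simp
    thus "x \<in> ?T t -` box l u" unfolding vimage_eq using y(1) by (simp only:)
  qed
  have "box l u \<in> lmeasurable" by simp
  hence Abox: "A ` box l u \<in> lmeasurable" "measure lebesgue (A ` box l u) = measure lebesgue (box l u)"
    using measurable_linear_image[OF \<open>linear A\<close>] measure_linear_image[OF \<open>linear A\<close>] \<open>det (matrix A) = 1\<close>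
    by auto
  hence "?T t -` box l u \<in> lmeasurable" "measure lebesgue (?T t -` box l u) = measure lebesgue (box l u)"
    unfolding inv by (simp_all only: measurable_translation measure_translation)
  hence "emeasure lebesgue (?T t -` box l u) = emeasure lebesgue (box l u)"
    using emeasure_eq_ennreal_measure[OF fmeasurableD2] \<open>box l u \<in> lmeasurable\<close> by metis
  moreover have "?T t -` box l u \<in> sets lborel"
    using measurable_sets[of "?T t" borel borel "box l u"] by simp
  ultimately have "emeasure lborel (?T t -` box l u) = emeasure lborel (box l u)"
    by simp
  thus "emeasure (distr lborel borel (?T t)) (box l u) = (\<Prod>b\<in>Basis. (u - l) \<bullet> b)"
    using lu by (simp add: emeasure_distr emeasure_lborel_box)
qed simp

text \<open>Every flow line spends time exactly 1 in the slab \<open>0 \<le> \<langle>hproj x, w\<rangle> \<le> 1\<close>, because this coordinate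
  grows with unit speed. So the integral does not change if \<open>F x\<close> is multiplied by the time that the line of
  \<open>x\<close> spends in the slab; exchanging the integrals and moving \<open>x\<close> by the measure-preserving flow puts
  the slab outside and the line integral of \<open>F\<close> inside.\<close>

lemma nn_integral_flow_lines:
  assumes [measurable]: "F \<in> borel_measurable borel" and w: "norm w = 1"
  shows "(\<integral>\<^sup>+x. F x \<partial>lborel)
    = (\<integral>\<^sup>+x. (\<integral>\<^sup>+t. F (x + t *\<^sub>R hfield w x) \<partial>lborel) * indicator {x. hproj x \<bullet> w \<in> {0..1}} x \<partial>lborel)"
proof -
  let ?T = "\<lambda>t x. x + t *\<^sub>R hfield w x"
  define B where "B = {x. hproj x \<bullet> w \<in> {0..1}}"
  have [measurable]: "hfield w \<in> borel_measurable borel"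
    by (intro borel_measurable_continuous_onI continuous_intros)
  have pair: "measurable (lborel \<Otimes>\<^sub>M lborel) M = measurable (borel \<Otimes>\<^sub>M borel) M" for M :: "ennreal measure"
    by (intro measurable_cong_sets sets_pair_measure_cong) simp_all
  have [measurable]: "B \<in> sets borel"
  proof (rule borel_closed)
    have "continuous_on UNIV (\<lambda>x. hproj x \<bullet> w)"
      unfolding hproj_def by (intro continuous_intros)
    thus "closed B" unfolding B_def atLeastAtMost_iff
      by (intro closed_Collect_conj closed_Collect_le continuous_on_const)
  qed
  have one: "(\<integral>\<^sup>+t. indicator B (?T (- t) x) \<partial>lborel) = (1::ennreal)" for x
  proof -
    let ?c = "hproj x \<bullet> w"
    have "hproj (?T (- t) x) \<bullet> w = ?c - t" for t
    proof -
      have "hproj (?T (- t) x) = hproj x - t *\<^sub>R w" by (simp add: hproj_def prod_eq_iff)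
      thus ?thesis using w by (simp add: inner_diff_left norm_eq_1)
    qed
    hence "(\<integral>\<^sup>+t. indicator B (?T (- t) x) \<partial>lborel) = (\<integral>\<^sup>+t. indicator {?c - 1..?c} t \<partial>lborel :: ennreal)"
      by (intro nn_integral_cong) (auto simp: B_def indicator_def)
    thus ?thesis by simp
  qed
  have "(\<integral>\<^sup>+x. F x \<partial>lborel) = (\<integral>\<^sup>+x. (\<integral>\<^sup>+t. F x * indicator B (?T (- t) x) \<partial>lborel) \<partial>lborel)"
  proof -
    have "(\<integral>\<^sup>+t. F x * indicator B (?T (- t) x) \<partial>lborel) = F x" for x
      by (subst nn_integral_cmult, measurable) (simp only: one mult_1_right)
    thus ?thesis by (simp only:)
  qed
  also have "\<dots> = (\<integral>\<^sup>+t. (\<integral>\<^sup>+x. F x * indicator B (?T (- t) x) \<partial>lborel) \<partial>lborel)"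
    by (rule lborel_pair.Fubini'[symmetric], unfold pair) measurable
  also have "\<dots> = (\<integral>\<^sup>+t. (\<integral>\<^sup>+x. F (?T t x) * indicator B x \<partial>lborel) \<partial>lborel)"
  proof (rule nn_integral_cong)
    fix t
    have "(\<integral>\<^sup>+x. F x * indicator B (?T (- t) x) \<partial>lborel)
        = (\<integral>\<^sup>+x. F x * indicator B (?T (- t) x) \<partial>distr lborel borel (?T t))"
      by (simp only: distr_lborel_flow)
    also have "\<dots> = (\<integral>\<^sup>+x. F (?T t x) * indicator B (?T (- t) (?T t x)) \<partial>lborel)"
      by (rule nn_integral_distr) measurable
    also have "\<dots> = (\<integral>\<^sup>+x. F (?T t x) * indicator B x \<partial>lborel)"
      by (simp add: hfield_along_line)
    finally show "(\<integral>\<^sup>+x. F x * indicator B (?T (- t) x) \<partial>lborel)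
      = (\<integral>\<^sup>+x. F (?T t x) * indicator B x \<partial>lborel)" .
  qed
  also have "\<dots> = (\<integral>\<^sup>+x. (\<integral>\<^sup>+t. F (?T t x) * indicator B x \<partial>lborel) \<partial>lborel)"
    by (rule lborel_pair.Fubini', unfold pair) measurable
  also have "\<dots> = (\<integral>\<^sup>+x. (\<integral>\<^sup>+t. F (?T t x) \<partial>lborel) * indicator B x \<partial>lborel)"
    by (intro nn_integral_cong nn_integral_multc) measurable
  finally show ?thesis unfolding B_def .
qed

section \<open>The Hardy inequality in the Heisenberg group\<close>

text \<open>Both sides are integrals over the slab of integrals along lines, and on every line the one-dimensional
  Hardy inequality applies to the restriction of \<open>u\<close>.\<close>

lemma hardy_flow:
  fixes u :: "heis \<Rightarrow> 'a::euclidean_space"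
  assumes \<Omega>: "open \<Omega>" "bounded \<Omega>" and w: "norm w = 1"
    and der: "\<And>x. (u has_derivative u' x) (at x)"
    and cont: "continuous_on UNIV (\<lambda>x. u' x (hfield w x))"
    and supp: "closure {x. u x \<noteq> 0} \<subseteq> \<Omega>"
  shows "(\<integral>\<^sup>+x. ennreal ((norm (u x))\<^sup>2 / (flow_dist \<Omega> w x)\<^sup>2) \<partial>lborel)
           \<le> 4 * (\<integral>\<^sup>+x. ennreal ((norm (u' x (hfield w x)))\<^sup>2) \<partial>lborel)"
proof -
  let ?T = "\<lambda>x t. x + t *\<^sub>R hfield w x"
  let ?B = "{x. hproj x \<bullet> w \<in> {0..1}}"
  let ?K = "closure {x. u x \<noteq> 0}"
  have w0: "w \<noteq> 0" using w by auto
  have "continuous_on UNIV u"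
    using der has_derivative_continuous_on has_derivative_at_withinI by blast
  hence [measurable]: "u \<in> borel_measurable borel" by (rule borel_measurable_continuous_onI)
  have [measurable]: "(\<lambda>x. u' x (hfield w x)) \<in> borel_measurable borel"
    by (rule borel_measurable_continuous_onI[OF cont])
  note [measurable] = flow_dist_borel_measurable[OF \<Omega> w0]
  have line: "(\<integral>\<^sup>+t. ennreal ((norm (u (?T x t)))\<^sup>2 / (flow_dist \<Omega> w (?T x t))\<^sup>2) \<partial>lborel)
      \<le> 4 * (\<integral>\<^sup>+t. ennreal ((norm (u' (?T x t) (hfield w (?T x t))))\<^sup>2) \<partial>lborel)" for x
    unfolding flow_dist_flow
  proof (rule hardy_open_real)
    have T: "continuous_on UNIV (?T x)" by (intro continuous_intros)
    show "open {s. ?T x s \<in> \<Omega>}"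
      using open_vimage[OF \<Omega>(1) T] by (simp add: vimage_def)
    show bdd: "bounded {s. ?T x s \<in> \<Omega>}" by (rule bounded_flow_preimage[OF \<Omega>(2) w0])
    show "((\<lambda>t. u (?T x t)) has_vector_derivative u' (?T x t) (hfield w (?T x t))) (at t)" for t
    proof -
      have "((\<lambda>t. ?T x t) has_vector_derivative hfield w x) (at t)"
        by (auto intro!: derivative_eq_intros)
      from has_derivative_compose[OF this[unfolded has_vector_derivative_def] der]
      show ?thesis
        unfolding has_vector_derivative_def hfield_along_line
        by (simp add: linear_cmul[OF has_derivative_linear[OF der]])
    qed
    show "continuous_on UNIV (\<lambda>t. u' (?T x t) (hfield w (?T x t)))"
      by (rule continuous_on_compose2[where g="\<lambda>x. u' x (hfield w x)" and f="?T x", OF cont T subset_UNIV])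
    have sub: "closure {t. u (?T x t) \<noteq> 0} \<subseteq> {s. ?T x s \<in> ?K}"
    proof (rule closure_minimal)
      show "closed {s. ?T x s \<in> ?K}"
        using closed_vimage[OF closed_closure T] by (simp add: vimage_def)
      show "{t. u (?T x t) \<noteq> 0} \<subseteq> {s. ?T x s \<in> ?K}"
        using closure_subset[of "{x. u x \<noteq> 0}"] by auto
    qed
    thus sub\<Omega>: "closure {t. u (?T x t) \<noteq> 0} \<subseteq> {s. ?T x s \<in> \<Omega>}" using supp by auto
    show "compact (closure {t. u (?T x t) \<noteq> 0})"
      using bounded_subset[OF bdd sub\<Omega>] by (simp add: compact_eq_bounded_closed)
  qed
  have "(\<integral>\<^sup>+x. ennreal ((norm (u x))\<^sup>2 / (flow_dist \<Omega> w x)\<^sup>2) \<partial>lborel)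
    = (\<integral>\<^sup>+x. (\<integral>\<^sup>+t. ennreal ((norm (u (?T x t)))\<^sup>2 / (flow_dist \<Omega> w (?T x t))\<^sup>2) \<partial>lborel)
         * indicator ?B x \<partial>lborel)"
    by (rule nn_integral_flow_lines[OF _ w]) measurable
  also have "\<dots> \<le> (\<integral>\<^sup>+x. 4 * (\<integral>\<^sup>+t. ennreal ((norm (u' (?T x t) (hfield w (?T x t))))\<^sup>2) \<partial>lborel)
         * indicator ?B x \<partial>lborel)"
    by (intro nn_integral_mono mult_right_mono line) auto
  also have "\<dots> = (\<integral>\<^sup>+x. (\<integral>\<^sup>+t. 4 * ennreal ((norm (u' (?T x t) (hfield w (?T x t))))\<^sup>2) \<partial>lborel)
         * indicator ?B x \<partial>lborel)"
  proof -
    have T: "continuous_on UNIV (?T x)" for x by (intro continuous_intros)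
    have "(\<lambda>t. u' (?T x t) (hfield w (?T x t))) \<in> borel_measurable borel" for x
      by (rule borel_measurable_continuous_onI,
          rule continuous_on_compose2[where g="\<lambda>x. u' x (hfield w x)" and f="?T x", OF cont T subset_UNIV])
    thus ?thesis by (simp add: nn_integral_cmult)
  qed
  also have "\<dots> = (\<integral>\<^sup>+x. 4 * ennreal ((norm (u' x (hfield w x)))\<^sup>2) \<partial>lborel)"
    by (rule nn_integral_flow_lines[OF _ w, symmetric]) measurable
  also have "\<dots> = 4 * (\<integral>\<^sup>+x. ennreal ((norm (u' x (hfield w x)))\<^sup>2) \<partial>lborel)"
    by (rule nn_integral_cmult) measurable
  finally show ?thesis .
qed

lemma X1_eq_frechet_derivative:
  assumes "u differentiable (at x)"
  shows "X1 u x = frechet_derivative u (at x) (hfield (1, 0) x)"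
proof -
  have *: "hfield (1, 0) x = axis 1 1 + (x$2 / 2) *\<^sub>R axis 3 1"
    by (intro heis_eqI) (auto simp: axis_def)
  have "linear (frechet_derivative u (at x))" using assms by (rule linear_frechet_derivative)
  thus ?thesis unfolding * X1_def partial_def
    by (simp add: linear_add linear_cmul) (simp add: scaleR_conv_of_real)
qed

lemma X2_eq_frechet_derivative:
  assumes "u differentiable (at x)"
  shows "X2 u x = frechet_derivative u (at x) (hfield (0, 1) x)"
proof -
  have *: "hfield (0, 1) x = axis 2 1 - (x$1 / 2) *\<^sub>R axis 3 1"
    by (intro heis_eqI) (auto simp: axis_def)
  have "linear (frechet_derivative u (at x))" using assms by (rule linear_frechet_derivative)
  thus ?thesis unfolding * X2_def partial_def
    by (simp add: linear_diff linear_cmul) (simp add: scaleR_conv_of_real)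
qed

lemma test_functionD:
  assumes "u \<in> test_functions \<Omega>"
  shows "u differentiable (at x)" "continuous_on UNIV u"
    and "continuous_on UNIV (X1 u)" "continuous_on UNIV (X2 u)"
    and "compact (closure {x. u x \<noteq> 0})" "closure {x. u x \<noteq> 0} \<subseteq> \<Omega>"
    and "x \<notin> closure {x. u x \<noteq> 0} \<Longrightarrow> subgrad_norm_sq u x = 0"
proof -
  have Ck: "Ck k u" for k using assms by (simp add: test_functions_def)
  show diff: "u differentiable (at x)" for x using Ck[of "Suc 0"] by simp
  show "continuous_on UNIV u" using Ck[of 0] by simp
  have [continuous_intros]: "continuous_on UNIV (partial i u)" for i using Ck[of "Suc 0"] by simp
  show "continuous_on UNIV (X1 u)" "continuous_on UNIV (X2 u)"
    unfolding X1_def[abs_def] X2_def[abs_def] by (intro continuous_intros; simp)+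
  show "compact (closure {x. u x \<noteq> 0})" "closure {x. u x \<noteq> 0} \<subseteq> \<Omega>"
    using assms by (auto simp: test_functions_def)
  assume x: "x \<notin> closure {x. u x \<noteq> 0}"
  have "((\<lambda>_. 0) has_derivative (\<lambda>_. 0)) (at x)" by simp
  hence "(u has_derivative (\<lambda>_. 0)) (at x)"
    by (rule has_derivative_transform_within_open[where s="- closure {x. u x \<noteq> 0}"])
       (use x closure_subset[of "{x. u x \<noteq> 0}"] in auto)
  hence "frechet_derivative u (at x) = (\<lambda>_. 0)" by (rule frechet_derivative_at[symmetric])
  thus "subgrad_norm_sq u x = 0"
    by (simp add: subgrad_norm_sq_def X1_eq_frechet_derivative[OF diff] X2_eq_frechet_derivative[OF diff])
qed

theorem theorem3p1:
  fixes \<Omega> :: "heis set"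
  assumes "open \<Omega>" and "bounded \<Omega>"
    and "\<And>x C. x \<in> \<Omega> \<Longrightarrow> C \<in> components (tangent_plane x \<inter> \<Omega>) \<Longrightarrow> convex C"
  shows "(\<forall>u \<in> test_functions \<Omega>.
            set_integrable lebesgue \<Omega> (\<lambda>x. (cmod (u x))\<^sup>2 / (omega \<Omega> x)\<^sup>2) \<and>
            set_integrable lebesgue \<Omega> (subgrad_norm_sq u) \<and>
            (LINT x:\<Omega>|lebesgue. (cmod (u x))\<^sup>2 / (omega \<Omega> x)\<^sup>2)
              \<le> 4 * (LINT x:\<Omega>|lebesgue. subgrad_norm_sq u x)) \<and>
         (\<forall>x \<in> \<Omega>.
            omega \<Omega> x = (INF y \<in> frontier \<Omega> \<inter> tangent_plane x. kaplan_gauge ((- y) \<boxplus> x)) \<and>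
            omega \<Omega> x = (INF y \<in> frontier \<Omega> \<inter> tangent_plane x.
                           sqrt ((x$1 - y$1)\<^sup>2 + (x$2 - y$2)\<^sup>2)))"
proof (intro conjI ballI)
  fix x
  show "omega \<Omega> x = (INF y \<in> frontier \<Omega> \<inter> tangent_plane x. kaplan_gauge ((- y) \<boxplus> x))"
    unfolding omega_eq_norm_hproj by (rule INF_cong) (auto simp: kaplan_gauge_tangent_plane)
  show "omega \<Omega> x = (INF y \<in> frontier \<Omega> \<inter> tangent_plane x. sqrt ((x$1 - y$1)\<^sup>2 + (x$2 - y$2)\<^sup>2))"
    unfolding omega_eq_norm_hproj by (rule INF_cong) (auto simp: norm_hproj power2_commute)
next
  fix u assume u: "u \<in> test_functions \<Omega>"
  note \<Omega> = assms(1,2) and U = test_functionD[OF u]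
  let ?K = "closure {x. u x \<noteq> 0}"
  define f where "f x = indicator \<Omega> x *\<^sub>R ((cmod (u x))\<^sup>2 / (omega \<Omega> x)\<^sup>2)" for x
  define h where "h = subgrad_norm_sq u"
  have [measurable]: "u \<in> borel_measurable borel" "X1 u \<in> borel_measurable borel"
    "X2 u \<in> borel_measurable borel"
    using U(2-4) by (auto intro: borel_measurable_continuous_onI)
  note [measurable] = omega_borel_measurable[OF \<Omega>]
  have f_eq: "f = (\<lambda>x. (cmod (u x))\<^sup>2 / (indicator \<Omega> x * omega \<Omega> x)\<^sup>2)"
    by (auto simp: f_def indicator_def)
  have [measurable]: "f \<in> borel_measurable borel" unfolding f_eq by measurable
  have h_cont: "continuous_on UNIV h"
    unfolding h_def subgrad_norm_sq_def by (intro continuous_intros U)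
  hence "integrable lborel (\<lambda>x. indicator ?K x *\<^sub>R h x)"
    using U(5) by (intro borel_integrable_compact) (auto intro: continuous_on_subset)
  moreover have "(\<lambda>x. indicator ?K x *\<^sub>R h x) = h"
  proof
    show "indicator ?K x *\<^sub>R h x = h x" for x
      using U(7)[of x] by (cases "x \<in> ?K") (auto simp: h_def)
  qed
  ultimately have h_int: "integrable lborel h" by (simp only:)
  \<comment> \<open>Hence integrals of \<open>h\<close> over \<open>\<Omega>\<close> and over the whole space coincide.\<close>
  have h_\<Omega>: "indicator \<Omega> x *\<^sub>R h x = h x" for x
    using U(6) U(7)[of x] by (auto simp: h_def indicator_def)
  have h_nonneg: "0 \<le> h x" for x by (simp add: h_def subgrad_norm_sq_def)
  have U': "(u has_derivative frechet_derivative u (at x)) (at x)" for x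
    using U(1) frechet_derivative_works by blast
  have hardy1: "(\<integral>\<^sup>+x. ennreal ((cmod (u x))\<^sup>2 / (flow_dist \<Omega> (1, 0) x)\<^sup>2) \<partial>lborel)
      \<le> 4 * (\<integral>\<^sup>+x. ennreal ((cmod (X1 u x))\<^sup>2) \<partial>lborel)"
    using hardy_flow[OF \<Omega> _ U' _ U(6), of "(1, 0)"] U(3)
    by (simp add: norm_Pair flip: X1_eq_frechet_derivative[OF U(1)])
  have hardy2: "(\<integral>\<^sup>+x. ennreal ((cmod (u x))\<^sup>2 / (flow_dist \<Omega> (0, 1) x)\<^sup>2) \<partial>lborel)
      \<le> 4 * (\<integral>\<^sup>+x. ennreal ((cmod (X2 u x))\<^sup>2) \<partial>lborel)"
    using hardy_flow[OF \<Omega> _ U' _ U(6), of "(0, 1)"] U(4)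
    by (simp add: norm_Pair flip: X2_eq_frechet_derivative[OF U(1)])
  have [measurable]: "flow_dist \<Omega> (1, 0) \<in> borel_measurable borel" "flow_dist \<Omega> (0, 1) \<in> borel_measurable borel"
    using flow_dist_borel_measurable[OF \<Omega>] by (auto simp: zero_prod_def)
  have pointwise: "f x \<le> (cmod (u x))\<^sup>2 / (flow_dist \<Omega> (1, 0) x)\<^sup>2 + (cmod (u x))\<^sup>2 / (flow_dist \<Omega> (0, 1) x)\<^sup>2" for x
  proof (cases "x \<in> \<Omega>")
    case True
    have "convex (connected_component_set (tangent_plane x \<inter> \<Omega>) x)"
      using assms(3)[OF True] True by (auto simp: components_def mem_tangent_plane)
    from mult_left_mono[OF inverse_omega_sq_le[OF \<Omega> True this], of "(cmod (u x))\<^sup>2"]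
    show ?thesis using True by (simp add: f_def distrib_left)
  qed (simp add: f_def)
  have "(\<integral>\<^sup>+x. ennreal (f x) \<partial>lborel)
      \<le> (\<integral>\<^sup>+x. ennreal ((cmod (u x))\<^sup>2 / (flow_dist \<Omega> (1, 0) x)\<^sup>2)
             + ennreal ((cmod (u x))\<^sup>2 / (flow_dist \<Omega> (0, 1) x)\<^sup>2) \<partial>lborel)"
    by (intro nn_integral_mono) (simp add: pointwise ennreal_leI flip: ennreal_plus)
  also have "\<dots> = (\<integral>\<^sup>+x. ennreal ((cmod (u x))\<^sup>2 / (flow_dist \<Omega> (1, 0) x)\<^sup>2) \<partial>lborel)
             + (\<integral>\<^sup>+x. ennreal ((cmod (u x))\<^sup>2 / (flow_dist \<Omega> (0, 1) x)\<^sup>2) \<partial>lborel)"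
    by (rule nn_integral_add) measurable
  also have "\<dots> \<le> 4 * (\<integral>\<^sup>+x. ennreal ((cmod (X1 u x))\<^sup>2) \<partial>lborel) + 4 * (\<integral>\<^sup>+x. ennreal ((cmod (X2 u x))\<^sup>2) \<partial>lborel)"
    by (intro add_mono hardy1 hardy2)
  also have "\<dots> = 4 * (\<integral>\<^sup>+x. ennreal ((cmod (X1 u x))\<^sup>2) + ennreal ((cmod (X2 u x))\<^sup>2) \<partial>lborel)"
    by (subst nn_integral_add) (auto simp: distrib_left)
  also have "\<dots> = 4 * (\<integral>\<^sup>+x. ennreal (h x) \<partial>lborel)"
    by (simp add: h_def subgrad_norm_sq_def)
  also have "\<dots> = ennreal (4 * (\<integral>x. h x \<partial>lborel))"
    using h_nonneg by (subst nn_integral_eq_integral[OF h_int]) (auto simp: ennreal_mult')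
  finally have le: "(\<integral>\<^sup>+x. ennreal (f x) \<partial>lborel) \<le> ennreal (4 * (\<integral>x. h x \<partial>lborel))" .
  have f_nonneg: "0 \<le> f x" for x by (simp add: f_def)
  \<comment> \<open>Integrability of the weighted side is a consequence of the inequality itself.\<close>
  have f_int: "integrable lborel f"
    using le f_nonneg by (intro integrableI_nonneg) (auto intro: le_less_trans)
  show "set_integrable lebesgue \<Omega> (\<lambda>x. (cmod (u x))\<^sup>2 / (omega \<Omega> x)\<^sup>2)"
    unfolding set_integrable_def f_def[symmetric] using f_int by (simp add: integrable_completion)
  show "set_integrable lebesgue \<Omega> (subgrad_norm_sq u)"
    unfolding set_integrable_def h_def[symmetric] h_\<Omega> using h_int by (simp add: integrable_completion)
  have "(\<integral>x. f x \<partial>lborel) \<le> 4 * (\<integral>x. h x \<partial>lborel)"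
    using le unfolding nn_integral_eq_integral[OF f_int AE_I2[OF f_nonneg]]
    by (subst (asm) ennreal_le_iff) (auto intro: Bochner_Integration.integral_nonneg h_nonneg)
  thus "(LINT x:\<Omega>|lebesgue. (cmod (u x))\<^sup>2 / (omega \<Omega> x)\<^sup>2) \<le> 4 * (LINT x:\<Omega>|lebesgue. subgrad_norm_sq u x)"
    unfolding set_lebesgue_integral_def f_def[symmetric] h_def[symmetric] h_\<Omega>
    using f_int h_int by (simp add: integral_completion)
qed

end
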